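(* Let $\lambda\in\mathbb{C}$ satisfy $0<|\lambda|<\frac{a}{2\max(n_+,n_-)}$, and let $T(\lambda)$ be the transition matrix defined by $u(\lambda,x)=T(\lambda)v(\lambda,x)$. Then (i) $\det T(\lambda)=\dfrac{m_-}{m_+}$; (ii) $T(\lambda)\,J\,T^*(\overline{\lambda})=k^2J$, where $k=\dfrac{n_-}{n_+}$ and $T^*(\overline\lambda)$ denotes the conjugate transpose of the matrix $T(\overline\lambda)$.
   Context: Setting: $m:\mathbb{R}\to\mathbb{R}$ is a measurable function having limits $m_\pm=\lim_{x\to\pm\infty}m(x)$ with $0<m_\pm<\infty$, and there is $a>0$ with $\int_{\mathbb{R}_\pm}|m(x)-m_\pm|^2e^{2a|x|}dx<\infty$. Put $n_\pm=m_\pm^{1/3}>0$, $z_\pm=\lambda n_\pm$. Let $\zeta_0=1$, $\zeta_1=\frac12(-1+i\sqrt3)$, $\zeta_2=\frac12(-1-i\sqrt3)$ and $s_2(z)=\frac13\left(e^{\zeta_0z}+\zeta_1^{-2}e^{\zeta_1z}+\zeta_2^{-2}e^{\zeta_2z}\right)$. The equation under study is $iy'''(x)=m(x)\lambda^3y(x)$, $x\in\mathbb{R}$ ($y,y',y''$ locally absolutely continuous, equation a.e.). Jost solutions at $+\infty$, for $|\lambda|<a/(2n_+)$ and $k=0,1,2$: $v_k(\lambda,x)=e^{iz_+\zeta_kx}+\int_x^\infty N(z_+,x,t)\left(\frac{m(t)}{m_+}-1\right)e^{iz_+\zeta_kt}dt$, where $N(z,x,t)=\sum_{n\ge1}(-iz)^nK_n(z,x,t)$,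 $K_1(z,x,t)=s_2(iz(x-t))$, $K_{n+1}(z,x,t)=\int_x^tK_n(z,x,s)\left(\frac{m(s)}{m_+}-1\right)K_1(z,s,t)ds$ ($x\le t$). It solves the equation and $v_k(\lambda,x)-e^{iz_+\zeta_kx}\to0$ as $x\to+\infty$. Jost solutions at $-\infty$, for $|\lambda|<a/(2n_-)$: $u_k(\lambda,x)=e^{iz_-\zeta_kx}+\int_{-\infty}^x\widehat N(z_-,x,t)\left(\frac{m(t)}{m_-}-1\right)e^{iz_-\zeta_kt}dt$, where $\widehat N(z,x,t)=\sum_{n\ge1}(iz)^n\widehat K_n(z,x,t)$, $\widehat K_1(z,x,t)=s_2(iz(x-t))$, $\widehat K_{n+1}(z,x,t)=\int_t^x\widehat K_n(z,x,s)\left(\frac{m(s)}{m_-}-1\right)\widehat K_1(z,s,t)ds$ ($t\le x$). It solves the equation and $u_k(\lambda,x)-e^{iz_-\zeta_kx}\to0$ as $x\to-\infty$. For $\lambda\ne0$ each triple is linearly independent. Put $u=\mathrm{col}[u_0,u_1,u_2]$, $v=\mathrm{col}[v_0,v_1,v_2]$; the transition matrix $T(\lambda)=[t_{k,l}(\lambda)]_{k,l=0}^2$ is the $x$-independent matrix with $u_k(\lambda,x)=\sum_{l=0}^2t_{k,l}(\lambda)v_l(\lambda,x)$. Finally $$J=\begin{pmatrix}1&0&0\\0&0&\zeta_2\\0&\zeta_1&0\end{pmatrix}.$$ *)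

theory Defs
  imports "HOL-Analysis.Analysis"
begin

definition zeta :: "nat \<Rightarrow> complex" where
  "zeta k = (if k = 0 then 1
             else if k = 1 then (- 1 + \<i> * of_real (sqrt 3)) / 2
             else (- 1 - \<i> * of_real (sqrt 3)) / 2)"

definition s2 :: "complex \<Rightarrow> complex" where
  "s2 z = (exp (zeta 0 * z) + zeta 1 powi (-2) * exp (zeta 1 * z)
             + zeta 2 powi (-2) * exp (zeta 2 * z)) / 3"

definition kernel1 :: "complex \<Rightarrow> real \<Rightarrow> real \<Rightarrow> complex" where
  "kernel1 z x t = s2 (\<i> * z * of_real (x - t))"

(* Throughout, q is the relative perturbation m/m_+ - 1 (resp. m/m_- - 1). The recursion starts at
   0, so kernel_plus q z n and kernel_minus q z n are the (n+1)-st iterated kernels, which is why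
   the series below carry the power Suc n. *)

primrec kernel_plus :: "(real \<Rightarrow> real) \<Rightarrow> complex \<Rightarrow> nat \<Rightarrow> real \<Rightarrow> real \<Rightarrow> complex" where
  "kernel_plus q z 0 x t = kernel1 z x t"
| "kernel_plus q z (Suc n) x t =
     (LINT s:{x..t}|lebesgue.
        kernel_plus q z n x s * of_real (q s) * kernel1 z s t)"

primrec kernel_minus :: "(real \<Rightarrow> real) \<Rightarrow> complex \<Rightarrow> nat \<Rightarrow> real \<Rightarrow> real \<Rightarrow> complex" where
  "kernel_minus q z 0 x t = kernel1 z x t"
| "kernel_minus q z (Suc n) x t =
     (LINT s:{t..x}|lebesgue.
        kernel_minus q z n x s * of_real (q s) * kernel1 z s t)"

definition resolvent_plus :: "(real \<Rightarrow> real) \<Rightarrow> complex \<Rightarrow> real \<Rightarrow> real \<Rightarrow> complex" where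
  "resolvent_plus q z x t = (\<Sum>n. (- \<i> * z) ^ Suc n * kernel_plus q z n x t)"

definition resolvent_minus :: "(real \<Rightarrow> real) \<Rightarrow> complex \<Rightarrow> real \<Rightarrow> real \<Rightarrow> complex" where
  "resolvent_minus q z x t = (\<Sum>n. (\<i> * z) ^ Suc n * kernel_minus q z n x t)"

(* Jost solutions of i y''' = m lam^3 y at plus infinity (v_k) and at minus infinity (u_k);
   mp and mm stand for the limits m_+ and m_- of m. *)

definition jost_plus ::
    "(real \<Rightarrow> real) \<Rightarrow> real \<Rightarrow> nat \<Rightarrow> complex \<Rightarrow> real \<Rightarrow> complex" where
  "jost_plus m mp k lam x =
     (let z = lam * of_real (root 3 mp); q = (\<lambda>t. m t / mp - 1) in
        exp (\<i> * z * zeta k * of_real x)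
        + (LINT t:{x..}|lebesgue.
             resolvent_plus q z x t * of_real (q t) * exp (\<i> * z * zeta k * of_real t)))"

definition jost_minus ::
    "(real \<Rightarrow> real) \<Rightarrow> real \<Rightarrow> nat \<Rightarrow> complex \<Rightarrow> real \<Rightarrow> complex" where
  "jost_minus m mm k lam x =
     (let z = lam * of_real (root 3 mm); q = (\<lambda>t. m t / mm - 1) in
        exp (\<i> * z * zeta k * of_real x)
        + (LINT t:{..x}|lebesgue.
             resolvent_minus q z x t * of_real (q t) * exp (\<i> * z * zeta k * of_real t)))"

definition jost_plus_col ::
    "(real \<Rightarrow> real) \<Rightarrow> real \<Rightarrow> complex \<Rightarrow> real \<Rightarrow> complex ^ 3" where
  "jost_plus_col m mp lam x =
     vector [jost_plus m mp 0 lam x, jost_plus m mp 1 lam x, jost_plus m mp 2 lam x]"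

definition jost_minus_col ::
    "(real \<Rightarrow> real) \<Rightarrow> real \<Rightarrow> complex \<Rightarrow> real \<Rightarrow> complex ^ 3" where
  "jost_minus_col m mm lam x =
     vector [jost_minus m mm 0 lam x, jost_minus m mm 1 lam x, jost_minus m mm 2 lam x]"

(* The description is well defined for 0 < |lam| < a / (2 max(n_+, n_-)), where both triples
   of Jost solutions are bases of the solution space; outside that range it is unspecified. *)
definition transition_matrix ::
    "(real \<Rightarrow> real) \<Rightarrow> real \<Rightarrow> real \<Rightarrow> complex \<Rightarrow> complex ^ 3 ^ 3" where
  "transition_matrix m mp mm lam =
     (THE T. \<forall>x. jost_minus_col m mm lam x = T *v jost_plus_col m mp lam x)"

definition J_mat :: "complex ^ 3 ^ 3" where
  "J_mat = vector [vector [1, 0, 0],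
                   vector [0, 0, zeta 2],
                   vector [0, zeta 1, 0]]"

definition conj_transpose :: "complex ^ 'n ^ 'm \<Rightarrow> complex ^ 'm ^ 'n" where
  "conj_transpose A = (\<chi> i j. cnj (A $ j $ i))"

end

(* Writing q for the relative perturbation and kappa = i z, the series defining a Jost solution is
   the Neumann series of v = e - kappa K v with the Volterra kernel s2 (kappa (x - t)) q(t); the
   bounds |K_n| <= exp(|z| (t - x)) Q^n / n! give convergence. The integral equation yields
   v''' = kappa^3 (1 + q) v in integrated form and v^(j) = (kappa zeta_k)^j e_k + o(exp(-|z| x)).
   Solutions at -infinity are reflections of solutions at +infinity.

   The Wronskian of three solutions is constant, and so is the bracket
   y'' conj(w) - y' conj(w') + y conj(w'') of solutions y at lam and w at conj(lam). The error
   terms decay fast enough to evaluate both at infinity: the Wronskian is kappa^3 times the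
   Vandermonde determinant of the zeta_k, and the Gram matrix of the bracket is 3 kappa^2 J.
   Comparing the values at both ends gives the two claims. *)
theory Submission
  imports Defs
begin

section \<open>Locally absolutely continuous functions\<close>

text \<open>The waves dictate the error size. Since exp(kappa zeta_k x) may grow like exp(|z| x), a
  product of wave and error vanishes at infinity only if the error is o(exp(-|z| x)). One factor
  exp(|z| t) for the kernel and one for the wave account for the weight exp(2 |z| t) required of q.
  Extracting an integrable q with this weight from the square-integrable one with weight exp(2 a
  |x|) needs 2 |z| < a, which is the bound imposed on |lambda|.

  The two ends are linked through the bracket: paired with the Jost solutions at conj(lambda), it
  supplies an explicit inverse of the jet matrix, hence the expansion coefficients. Since the
  transition matrix is a definite description, their uniqueness has to be shown as well; it rests on
  the jet matrix being invertible, which the Gram matrix also provides. The Vandermonde determinant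
  is the same at both ends, so only its being nonzero matters, not its value.\<close>

text \<open>The locally absolutely continuous functions, with almost everywhere derivative \<open>f\<close>, in integrated form:
  no differentiation of absolutely continuous functions is ever needed.\<close>

definition has_density :: "(real \<Rightarrow> 'a::{banach,second_countable_topology}) \<Rightarrow> (real \<Rightarrow> 'a) \<Rightarrow> bool" where
  "has_density F f \<longleftrightarrow>
     (\<forall>a b. a \<le> b \<longrightarrow> set_integrable lborel {a..b} f \<and> (LINT t:{a..b}|lborel. f t) = F b - F a)"

lemma has_densityI:
  assumes "\<And>a b. a \<le> b \<Longrightarrow> set_integrable lborel {a..b} f"
    and "\<And>a b. a \<le> b \<Longrightarrow> (LINT t:{a..b}|lborel. f t) = F b - F a"
  shows "has_density F f"
  using assms unfolding has_density_def by blast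

lemma has_densityD:
  assumes "has_density F f" "a \<le> b"
  shows "set_integrable lborel {a..b} f" "(LINT t:{a..b}|lborel. f t) = F b - F a"
  using assms unfolding has_density_def by blast+

lemma has_density_const: "has_density (\<lambda>x. c) (\<lambda>x. 0)"
  by (rule has_densityI) (simp_all add: set_integrable_def set_lebesgue_integral_def)

lemma has_density_add:
  assumes "has_density F f" "has_density G g"
  shows "has_density (\<lambda>x. F x + G x) (\<lambda>x. f x + g x)"
  using assms unfolding has_density_def by (auto simp: set_integral_add)

lemma has_density_diff:
  assumes "has_density F f" "has_density G g"
  shows "has_density (\<lambda>x. F x - G x) (\<lambda>x. f x - g x)"
  using assms unfolding has_density_def by (auto simp: set_integral_diff)

lemma has_density_cmult:
  fixes f :: "real \<Rightarrow> 'a::{real_normed_field,banach,second_countable_topology}"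
  assumes "has_density F f"
  shows "has_density (\<lambda>x. c * F x) (\<lambda>x. c * f x)"
  using assms unfolding has_density_def by (auto simp: right_diff_distrib)

lemma has_density_continuous_on:
  fixes f :: "real \<Rightarrow> 'a::euclidean_space"
  assumes "has_density F f"
  shows "continuous_on S F"
proof -
  have "isCont F x" for x
  proof -
    have "continuous_on {x-1..x+1} (\<lambda>y. F (x-1) + integral {x-1..y} f)"
      using has_densityD[OF assms, of "x-1" "x+1"]
      by (intro continuous_intros indefinite_integral_continuous_1 set_borel_integral_eq_integral) auto
    moreover have "F (x-1) + integral {x-1..y} f = F y" if "y \<in> {x-1..x+1}" for y
      using has_densityD[OF assms, of "x-1" y] that
      by (simp add: set_borel_integral_eq_integral(2)[symmetric])
    ultimately have "continuous_on {x-1..x+1} F"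
      by (rule continuous_on_eq)
    then show ?thesis
      by (rule continuous_on_interior) simp
  qed
  then show ?thesis
    by (simp add: continuous_at_imp_continuous_on)
qed

lemma has_density_of_deriv:
  fixes F :: "real \<Rightarrow> 'a::euclidean_space"
  assumes "\<And>x. (F has_vector_derivative f x) (at x)" "continuous_on UNIV f"
  shows "has_density F f"
proof (rule has_densityI)
  fix a b :: real assume ab: "a \<le> b"
  have cont: "continuous_on {a..b} f"
    using assms(2) by (rule continuous_on_subset) simp
  show *: "set_integrable lborel {a..b} f"
    unfolding set_integrable_def using cont
    by (intro borel_integrable_compact) auto
  have "(f has_integral (F b - F a)) {a..b}"
    using assms(1) ab by (intro fundamental_theorem_of_calculus) (auto intro: has_vector_derivative_at_within)
  then show "(LINT t:{a..b}|lborel. f t) = F b - F a"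
    using set_borel_integral_eq_integral(2)[OF *] by (simp add: integral_unique)
qed

lemma has_density_imp_deriv:
  fixes F :: "real \<Rightarrow> 'a::euclidean_space"
  assumes "has_density F f" "continuous_on UNIV f"
  shows "(F has_vector_derivative f x) (at x)"
proof -
  have "((\<lambda>u. integral {x-1..u} f) has_vector_derivative f x) (at x within {x-1..x+1})"
    using assms(2) by (intro integral_has_vector_derivative) (auto intro: continuous_on_subset)
  then have "((\<lambda>u. F (x-1) + integral {x-1..u} f) has_vector_derivative f x) (at x within {x-1..x+1})"
    by (auto intro!: derivative_eq_intros)
  moreover have "F (x-1) + integral {x-1..y} f = F y" if "y \<in> {x-1..x+1}" for y
    using has_densityD[OF assms(1), of "x-1" y] that
    by (simp add: set_borel_integral_eq_integral(2)[symmetric])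
  ultimately have "(F has_vector_derivative f x) (at x within {x-1..x+1})"
    by (elim has_vector_derivative_transform[rotated 2]) auto
  moreover have "at x within {x-1..x+1} = at x"
    by (rule at_within_interior) simp
  ultimately show ?thesis by simp
qed

lemma has_density_zero_const:
  assumes "has_density F (\<lambda>x. 0)"
  shows "F x = F y"
proof -
  have "F b = F a" if "a \<le> b" for a b
    using has_densityD(2)[OF assms that] by (simp add: set_lebesgue_integral_def)
  then show ?thesis
    by (cases "x \<le> y") auto
qed

lemma has_density_reflect:
  fixes f :: "real \<Rightarrow> 'a::{banach,second_countable_topology}"
  assumes "has_density F f"
  shows "has_density (\<lambda>x. F (- x)) (\<lambda>x. - f (- x))"
proof (rule has_densityI)
  fix a b :: real assume ab: "a \<le> b"
  have *: "indicator {a..b} x *\<^sub>R f (- x) = indicator {-b..-a} (0 + -1 * x) *\<^sub>R f (0 + -1 * x)" for x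
    by (auto simp: indicator_def)
  have D: "set_integrable lborel {-b..-a} f" "(LINT t:{-b..-a}|lborel. f t) = F (-a) - F (-b)"
    using has_densityD[OF assms, of "-b" "-a"] ab by auto
  have "set_integrable lborel {a..b} (\<lambda>x. f (- x))"
    unfolding set_integrable_def * by (rule lborel_integrable_real_affine)
      (use D(1) in \<open>simp_all add: set_integrable_def\<close>)
  then show "set_integrable lborel {a..b} (\<lambda>x. - f (- x))"
    by (simp add: set_integrable_def)
  have "(LINT t:{a..b}|lborel. f (- t)) = F (-a) - F (-b)"
    unfolding D(2)[symmetric] set_lebesgue_integral_def *
    by (subst (2) lborel_integral_real_affine[of "-1" _ 0]) simp_all
  then show "(LINT t:{a..b}|lborel. - f (- t)) = F (- b) - F (- a)"
    by (simp add: set_lebesgue_integral_def)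
qed

lemma has_density_cnj:
  assumes "has_density F f"
  shows "has_density (\<lambda>x. cnj (F x)) (\<lambda>x. cnj (f x))"
proof -
  have *: "indicator A x *\<^sub>R cnj (f x) = cnj (indicator A x *\<^sub>R f x)" for A x
    by simp
  show ?thesis
    using assms unfolding has_density_def set_integrable_def set_lebesgue_integral_def *
    by (simp del: complex_cnj_scaleR)
qed

section \<open>The product rule for densities\<close>

lemma Fubini_integral_dominated:
  fixes f :: "real \<Rightarrow> real \<Rightarrow> 'a::{banach,second_countable_topology}"
  assumes meas: "(\<lambda>(s, t). f s t) \<in> borel_measurable (lborel \<Otimes>\<^sub>M lborel)"
    and A: "integrable lborel A" and B: "integrable lborel B"
    and bound: "\<And>s t. norm (f s t) \<le> A s * B t"
  shows "(\<integral>t. \<integral>s. f s t \<partial>lborel \<partial>lborel) = (\<integral>s. \<integral>t. f s t \<partial>lborel \<partial>lborel)"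
proof -
  have [measurable]: "A \<in> borel_measurable borel" "B \<in> borel_measurable borel"
    using A B by (auto dest: borel_measurable_integrable)
  have "integrable (lborel \<Otimes>\<^sub>M lborel) (\<lambda>p. A (fst p) * B (snd p))"
  proof (rule lborel_pair.Fubini_integrable)
    show "(\<lambda>p. A (fst p) * B (snd p)) \<in> borel_measurable (lborel \<Otimes>\<^sub>M lborel)"
      by measurable
    have "integrable lborel (\<lambda>x. norm (A x) * (\<integral>y. norm (B y) \<partial>lborel))"
      using A by (intro integrable_mult_left) simp
    then show "integrable lborel (\<lambda>x. \<integral>y. norm (A (fst (x, y)) * B (snd (x, y))) \<partial>lborel)"
      by (simp add: abs_mult)
    show "AE x in lborel. integrable lborel (\<lambda>y. A (fst (x, y)) * B (snd (x, y)))"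
      using B by simp
  qed
  then have "integrable (lborel \<Otimes>\<^sub>M lborel) (\<lambda>(s, t). f s t)"
  proof (rule Bochner_Integration.integrable_bound)
    show "AE p in lborel \<Otimes>\<^sub>M lborel. norm (case p of (s, t) \<Rightarrow> f s t) \<le> norm (A (fst p) * B (snd p))"
      using bound by (intro AE_I2) (auto split: prod.split intro: order_trans[OF _ abs_ge_self] simp del: abs_mult)
  qed (rule meas)
  then show ?thesis
    by (rule lborel_pair.Fubini_integral)
qed

lemma set_integrable_mult_continuous:
  fixes f g :: "real \<Rightarrow> 'a::{real_normed_field,banach,second_countable_topology}"
  assumes f: "set_integrable lborel {a..b} f" and g: "continuous_on {a..b} g"
  shows "set_integrable lborel {a..b} (\<lambda>x. f x * g x)"
proof -
  obtain C where C: "\<And>x. x \<in> {a..b} \<Longrightarrow> norm (g x) \<le> C"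
    using compact_imp_bounded[OF compact_continuous_image[OF g compact_Icc]]
    unfolding bounded_iff by blast
  let ?g = "\<lambda>x. indicator {a..b} x *\<^sub>R g x"
  have [measurable]: "?g \<in> borel_measurable borel"
    using g by (rule borel_measurable_continuous_on_indicator[rotated]) simp
  have "integrable lborel (\<lambda>x. (indicator {a..b} x *\<^sub>R f x) * ?g x)"
  proof (rule Bochner_Integration.integrable_bound)
    show "integrable lborel (\<lambda>x. C *\<^sub>R (indicator {a..b} x *\<^sub>R f x))"
      using f unfolding set_integrable_def by (rule integrable_scaleR_right)
    have [measurable]: "(\<lambda>x. indicator {a..b} x *\<^sub>R f x) \<in> borel_measurable borel"
      using f by (auto simp: set_integrable_def dest: borel_measurable_integrable)
    show "(\<lambda>x. (indicator {a..b} x *\<^sub>R f x) * ?g x) \<in> borel_measurable lborel"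
      by measurable
    show "AE x in lborel. norm ((indicator {a..b} x *\<^sub>R f x) * ?g x) \<le> norm (C *\<^sub>R (indicator {a..b} x *\<^sub>R f x))"
    proof (intro AE_I2)
      fix x show "norm ((indicator {a..b} x *\<^sub>R f x) * ?g x) \<le> norm (C *\<^sub>R (indicator {a..b} x *\<^sub>R f x))"
        using mult_left_mono[OF order_trans[OF C abs_ge_self], of x "norm (f x)"]
        by (cases "x \<in> {a..b}") (auto simp: norm_mult mult.commute)
    qed
  qed
  moreover have "(\<lambda>x. (indicator {a..b} x *\<^sub>R f x) * ?g x) = (\<lambda>x. indicator {a..b} x *\<^sub>R (f x * g x))"
    by (auto simp: indicator_def)
  ultimately show ?thesis
    unfolding set_integrable_def by metis
qed

text \<open>Integrating out \<open>s\<close> over a triangle produces \<open>G t - G a\<close>,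
  integrating out \<open>t\<close> produces \<open>F b - F s\<close>; equating the two is
  integration by parts. No pointwise derivative enters.\<close>

lemma has_density_mult:
  fixes f g :: "real \<Rightarrow> 'a::{real_normed_field,euclidean_space}"
  assumes f: "has_density F f" and g: "has_density G g"
  shows "has_density (\<lambda>x. F x * G x) (\<lambda>x. f x * G x + F x * g x)"
proof -
  have int1: "set_integrable lborel {a..b} (\<lambda>x. f x * G x)"
    and int2: "set_integrable lborel {a..b} (\<lambda>x. g x * F x)" if "a \<le> b" for a b
    using has_densityD(1)[OF f that] has_densityD(1)[OF g that] has_density_continuous_on[OF f]
      has_density_continuous_on[OF g] by (auto intro: set_integrable_mult_continuous)
  show ?thesis
  proof (rule has_densityI)
    fix a b :: real assume ab: "a \<le> b"
    show "set_integrable lborel {a..b} (\<lambda>x. f x * G x + F x * g x)"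
      using int1[OF ab] int2[OF ab] by (simp add: mult.commute set_integral_add)
    define f' where "f' x = indicator {a..b} x *\<^sub>R f x" for x
    define g' where "g' x = indicator {a..b} x *\<^sub>R g x" for x
    have f': "integrable lborel f'" and g': "integrable lborel g'"
      using has_densityD(1)[OF f ab] has_densityD(1)[OF g ab]
      by (simp_all add: f'_def[abs_def] g'_def[abs_def] set_integrable_def)
    have [measurable]: "f' \<in> borel_measurable borel" "g' \<in> borel_measurable borel"
      using f' g' by (auto dest: borel_measurable_integrable)
    \<comment> \<open>Evaluate the integral of \<open>g s * f t\<close> over the triangle \<open>a \<le> s \<le> t \<le> b\<close> in both orders.\<close>
    have "(\<integral>t. \<integral>s. (if s \<le> t then g' s * f' t else 0) \<partial>lborel \<partial>lborel) =
          (\<integral>s. \<integral>t. (if s \<le> t then g' s * f' t else 0) \<partial>lborel \<partial>lborel)"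
      by (rule Fubini_integral_dominated[where A = "\<lambda>s. norm (g' s)" and B = "\<lambda>t. norm (f' t)"])
        (use f' g' in \<open>simp_all add: norm_mult\<close>)
    moreover have "(\<integral>s. (if s \<le> t then g' s * f' t else 0) \<partial>lborel) =
        indicator {a..b} t *\<^sub>R (f t * G t - G a * f t)" for t
    proof (cases "t \<in> {a..b}")
      case True
      then have "(\<integral>s. (if s \<le> t then g' s * f' t else 0) \<partial>lborel) =
          (\<integral>s. (indicator {a..t} s *\<^sub>R g s) * f t \<partial>lborel)"
        by (intro Bochner_Integration.integral_cong) (auto simp: f'_def g'_def indicator_def)
      also have "\<dots> = (G t - G a) * f t"
        using has_densityD[OF g, of a t] True
        by (simp add: set_lebesgue_integral_def set_integrable_def del: mult_scaleR_left)
      finally show ?thesis using True by (simp add: algebra_simps)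
    qed (simp add: f'_def cong: if_cong)
    moreover have "(\<integral>t. (if s \<le> t then g' s * f' t else 0) \<partial>lborel) =
        indicator {a..b} s *\<^sub>R (F b * g s - g s * F s)" for s
    proof (cases "s \<in> {a..b}")
      case True
      then have "(\<integral>t. (if s \<le> t then g' s * f' t else 0) \<partial>lborel) =
          (\<integral>t. g s * (indicator {s..b} t *\<^sub>R f t) \<partial>lborel)"
        by (intro Bochner_Integration.integral_cong) (auto simp: f'_def g'_def indicator_def)
      also have "\<dots> = g s * (F b - F s)"
        using has_densityD[OF f, of s b] True
        by (simp add: set_lebesgue_integral_def set_integrable_def del: mult_scaleR_right)
      finally show ?thesis using True by (simp add: algebra_simps)
    qed (simp add: g'_def cong: if_cong)
    ultimately have "(LINT t:{a..b}|lborel. f t * G t - G a * f t) =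
        (LINT t:{a..b}|lborel. F b * g t - g t * F t)"
      by (simp add: set_lebesgue_integral_def)
    then have "(LINT t:{a..b}|lborel. f t * G t) + (LINT t:{a..b}|lborel. g t * F t) =
        G a * (LINT t:{a..b}|lborel. f t) + F b * (LINT t:{a..b}|lborel. g t)"
      using int1[OF ab] int2[OF ab] has_densityD(1)[OF f ab] has_densityD(1)[OF g ab]
      by (simp add: algebra_simps)
    also have "\<dots> = F b * G b - F a * G a"
      by (simp add: has_densityD(2)[OF f ab] has_densityD(2)[OF g ab] algebra_simps)
    finally have "(LINT t:{a..b}|lborel. f t * G t) + (LINT t:{a..b}|lborel. g t * F t) =
        F b * G b - F a * G a" .
    then show "(LINT t:{a..b}|lborel. f t * G t + F t * g t) = F b * G b - F a * G a"
      using int1[OF ab] int2[OF ab] by (simp add: mult.commute)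
  qed
qed

lemma has_density_power:
  fixes f :: "real \<Rightarrow> 'a::{real_normed_field,euclidean_space}"
  assumes "has_density F f"
  shows "has_density (\<lambda>x. F x ^ Suc n) (\<lambda>x. of_nat (Suc n) * (F x ^ n * f x))"
proof (induction n)
  case (Suc n)
  show ?case
    using has_density_mult[OF assms Suc.IH] by (simp add: algebra_simps)
qed (use assms in simp)

section \<open>Dominated integrals, series and tails\<close>

lemma norm_integral_le:
  fixes f :: "'a \<Rightarrow> 'b::{banach,second_countable_topology}"
  assumes "integrable M g" "\<And>x. norm (f x) \<le> g x"
  shows "norm (integral\<^sup>L M f) \<le> integral\<^sup>L M g"
proof (rule order_trans[OF integral_norm_bound integral_mono'])
  show "0 \<le> g x" for x
    using order_trans[OF norm_ge_zero assms(2)] .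
qed (use assms in auto)

lemma norm_set_integral_le:
  fixes f :: "real \<Rightarrow> 'b::{banach,second_countable_topology}"
  assumes "set_integrable M A g" "\<And>x. x \<in> A \<Longrightarrow> norm (f x) \<le> g x"
  shows "norm (set_lebesgue_integral M A f) \<le> set_lebesgue_integral M A g"
  unfolding set_lebesgue_integral_def
  by (rule norm_integral_le) (use assms in \<open>auto simp: set_integrable_def indicator_def\<close>)

lemma set_integrable_dominated:
  fixes f :: "real \<Rightarrow> 'b::{banach,second_countable_topology}"
  assumes "set_integrable lborel A g" "f \<in> borel_measurable borel" "A \<in> sets borel"
    and "\<And>x. x \<in> A \<Longrightarrow> norm (f x) \<le> g x"
  shows "set_integrable lborel A f"
  unfolding set_integrable_def
proof (rule Bochner_Integration.integrable_bound)
  show "integrable lborel (\<lambda>x. indicator A x *\<^sub>R g x)"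
    using assms(1) by (simp add: set_integrable_def)
  show "(\<lambda>x. indicator A x *\<^sub>R f x) \<in> borel_measurable lborel"
    using assms(2,3) by measurable
  show "AE x in lborel. norm (indicator A x *\<^sub>R f x) \<le> norm (indicator A x *\<^sub>R g x)"
    using assms(4) by (intro AE_I2) (auto simp: indicator_def intro: order_trans[OF _ abs_ge_self])
qed

text \<open>The separated majorant fits the two interchanges needed for the Neumann series:
  \<open>A n\<close> carries the factorials, and the integrable part is a multiple of the weighted
  perturbation.\<close>

lemma set_integral_suminf_dominated:
  fixes g :: "nat \<Rightarrow> real \<Rightarrow> 'b::{banach,second_countable_topology}"
  assumes meas: "\<And>n. g n \<in> borel_measurable borel" and S: "S \<in> sets borel"
    and bound: "\<And>n t. t \<in> S \<Longrightarrow> norm (g n t) \<le> A n * H t"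
    and A: "summable A" and H: "set_integrable lborel S H"
  shows "(\<lambda>n. LINT t:S|lborel. g n t) sums (LINT t:S|lborel. (\<Sum>n. g n t))"
proof -
  have AH: "set_integrable lborel S (\<lambda>t. A n * H t)" for n
    using H by simp
  have int: "set_integrable lborel S (g n)" for n
    using AH meas S bound by (rule set_integrable_dominated)
  have "(\<lambda>n. \<integral>t. indicator S t *\<^sub>R g n t \<partial>lborel) sums (\<integral>t. (\<Sum>n. indicator S t *\<^sub>R g n t) \<partial>lborel)"
  proof (rule sums_integral)
    show "integrable lborel (\<lambda>t. indicator S t *\<^sub>R g n t)" for n
      using int by (simp add: set_integrable_def)
    have "summable (\<lambda>n. norm (indicator S t *\<^sub>R g n t))" for t
    proof (rule summable_comparison_test')
      show "summable (\<lambda>n. A n * (indicator S t * H t))"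
        using A by (rule summable_mult2)
      show "norm (norm (indicator S t *\<^sub>R g n t)) \<le> A n * (indicator S t * H t)" if "n \<ge> 0" for n
        using bound by (auto simp: indicator_def)
    qed
    then show "AE t in lborel. summable (\<lambda>n. norm (indicator S t *\<^sub>R g n t))"
      by simp
    show "summable (\<lambda>n. \<integral>t. norm (indicator S t *\<^sub>R g n t) \<partial>lborel)"
    proof (rule summable_comparison_test')
      show "summable (\<lambda>n. A n * (LINT t:S|lborel. H t))"
        using A by (rule summable_mult2)
      fix n
      have "norm (\<integral>t. norm (indicator S t *\<^sub>R g n t) \<partial>lborel) \<le> (\<integral>t. indicator S t *\<^sub>R (A n * H t) \<partial>lborel)"
        using AH bound by (intro norm_integral_le) (auto simp: set_integrable_def indicator_def)
      then show "norm (\<integral>t. norm (indicator S t *\<^sub>R g n t) \<partial>lborel) \<le> A n * (LINT t:S|lborel. H t)"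
        by (simp add: set_lebesgue_integral_def mult.left_commute)
    qed
  qed
  moreover have "(\<Sum>n. indicator S t *\<^sub>R g n t) = indicator S t *\<^sub>R (\<Sum>n. g n t)" for t
    by (simp add: indicator_def)
  ultimately show ?thesis
    by (simp add: set_lebesgue_integral_def)
qed

lemma tail_integral_split:
  fixes f :: "real \<Rightarrow> 'b::{banach,second_countable_topology}"
  assumes "set_integrable lborel {a..} f" "a \<le> b"
  shows "(LINT t:{a..}|lborel. f t) = (LINT t:{a..b}|lborel. f t) + (LINT t:{b..}|lborel. f t)"
proof -
  have "(LINT t:{a..b} \<union> {b..}|lborel. f t) = (LINT t:{a..b}|lborel. f t) + (LINT t:{b..}|lborel. f t)"
  proof (rule set_integral_Un_AE)
    have "AE t in lborel. t \<noteq> b"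
      by (rule AE_lborel_singleton)
    then show "AE t in lborel. \<not> (t \<in> {a..b} \<and> t \<in> {b..})"
      by eventually_elim auto
  qed (use assms in \<open>auto intro: set_integrable_subset\<close>)
  moreover have "{a..b} \<union> {b..} = {a..}"
    using assms(2) by auto
  ultimately show ?thesis by simp
qed

lemma has_density_tail:
  fixes f :: "real \<Rightarrow> 'b::{banach,second_countable_topology}"
  assumes "\<And>x. set_integrable lborel {x..} f"
  shows "has_density (\<lambda>x. LINT t:{x..}|lborel. f t) (\<lambda>x. - f x)"
proof (rule has_densityI)
  fix a b :: real assume ab: "a \<le> b"
  have "set_integrable lborel {a..b} f"
    using assms[of a] by (rule set_integrable_subset) auto
  then show "set_integrable lborel {a..b} (\<lambda>x. - f x)"
    by (simp add: set_integrable_def)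
  show "(LINT t:{a..b}|lborel. - f t) = (LINT t:{b..}|lborel. f t) - (LINT t:{a..}|lborel. f t)"
    using tail_integral_split[OF assms ab] by (simp add: set_lebesgue_integral_def)
qed

text \<open>Kernels and Jost solutions are defined by Lebesgue integrals, whereas Fubini is applied
  over \<open>lborel\<close>; for Borel integrands the completion changes nothing.\<close>

lemma set_integral_lebesgue_eq_lborel:
  fixes f :: "real \<Rightarrow> 'b::{banach,second_countable_topology}"
  assumes "f \<in> borel_measurable borel" "A \<in> sets borel"
  shows "set_lebesgue_integral lebesgue A f = set_lebesgue_integral lborel A f"
  unfolding set_lebesgue_integral_def
  by (rule integral_completion) (use assms in measurable)

section \<open>Iterated kernels and the Volterra equation\<close>

lemma zeta_sqrt3: "complex_of_real (sqrt 3) * of_real (sqrt 3) = 3"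
  by (simp flip: of_real_mult)

lemma zeta_cube: "zeta k ^ 3 = 1"
  using zeta_sqrt3 by (auto simp: zeta_def power3_eq_cube field_simps)

lemma norm_zeta [simp]: "norm (zeta k) = 1"
proof -
  have "norm (zeta k) ^ 3 = 1"
    by (simp add: zeta_cube flip: norm_power)
  then show ?thesis
    using power_eq_imp_eq_base[of "norm (zeta k)" 3 1] by simp
qed

lemma zeta_powi: "zeta k powi (-2) = zeta k"
proof -
  have "zeta k \<noteq> 0"
    by (metis norm_zeta norm_zero zero_neq_one)
  then show ?thesis
    using zeta_cube[of k] by (simp add: power_int_minus field_simps power2_eq_square power3_eq_cube)
qed

lemma s2_eq: "s2 w = (\<Sum>j<3. zeta j * exp (zeta j * w)) / 3"
  by (simp add: s2_def zeta_powi eval_nat_numeral) (simp add: zeta_def)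

lemma sum_zeta: "(\<Sum>j<3. zeta j) = 0" "(\<Sum>j<3. zeta j ^ 2) = 0"
  using zeta_sqrt3 by (simp_all add: eval_nat_numeral zeta_def field_simps)

lemma norm_exp_zeta_le: "norm (exp (zeta k * w)) \<le> exp (norm w)"
  using norm_exp[of "zeta k * w"] by (simp add: norm_mult)

lemma norm_s2_le: "norm (s2 w) \<le> exp (norm w)"
proof -
  have "norm (\<Sum>j<3. zeta j * exp (zeta j * w)) \<le> (\<Sum>j<3::nat. exp (norm w))"
    by (intro sum_norm_le) (simp only: norm_mult norm_zeta mult_1 norm_exp_zeta_le)
  then show ?thesis
    by (simp add: s2_eq norm_divide)
qed

lemma borel_measurable_s2 [measurable]: "s2 \<in> borel_measurable borel"
  unfolding s2_eq[abs_def] by measurable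

lemma norm_kernel1_le: "x \<le> t \<Longrightarrow> norm (kernel1 z x t) \<le> exp (norm z * (t - x))"
  using norm_s2_le[of "\<i> * z * of_real (x - t)"] 
  by (simp add: kernel1_def norm_mult flip: of_real_diff)

lemma borel_measurable_kernel1 [measurable (raw)]:
  assumes [measurable]: "f \<in> borel_measurable M" "g \<in> borel_measurable M"
  shows "(\<lambda>p. kernel1 z (f p) (g p)) \<in> borel_measurable M"
  unfolding kernel1_def by measurable

text \<open>The factor 2 in the weight: the kernel contributes exp(|z| (t - x)) and the function it
  acts on exp(|z| t), with product exp(- |z| x) exp(2 |z| t).\<close>

locale jost_problem =
  fixes q :: "real \<Rightarrow> real" and z :: complex
  assumes q_borel [measurable]: "q \<in> borel_measurable borel"
    and weight: "\<And>x. set_integrable lborel {x..} (\<lambda>t. q t * exp (2 * norm z * t))"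
begin

text \<open>The perturbation has two tails. Powers of the unweighted tail \<open>P\<close> produce
  the factorials in the kernel bounds; the weighted tail \<open>M\<close> of \<open>H\<close>
  finally makes the error terms small.\<close>

definition H :: "real \<Rightarrow> real" where "H t = \<bar>q t\<bar> * exp (2 * norm z * t)"
definition M :: "real \<Rightarrow> real" where "M x = (LINT t:{x..}|lborel. H t)"
definition P :: "real \<Rightarrow> real" where "P x = (LINT t:{x..}|lborel. \<bar>q t\<bar>)"

text \<open>The constant may depend on the left end \<open>x\<close>, because the general bound
  exp(|z| |t|) for a wave exceeds exp(|z| t) by an unbounded factor as t decreases.\<close>

definition growth :: "(real \<Rightarrow> complex) \<Rightarrow> bool" where
  "growth f \<longleftrightarrow> f \<in> borel_measurable borel \<and> (\<forall>x. \<exists>C\<ge>0. \<forall>t\<ge>x. norm (f t) \<le> C * exp (norm z * t))"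

definition ker_op :: "nat \<Rightarrow> (real \<Rightarrow> complex) \<Rightarrow> real \<Rightarrow> complex" where
  "ker_op n f x = (LINT t:{x..}|lborel. kernel_plus q z n x t * of_real (q t) * f t)"

lemma H_borel [measurable]: "H \<in> borel_measurable borel"
  unfolding H_def[abs_def] by measurable

lemma H_nonneg: "0 \<le> H t"
  by (simp add: H_def)

lemma H_integrable: "set_integrable lborel {x..} H"
  using set_integrable_norm[OF weight[of x]] by (simp add: H_def[abs_def] abs_mult)

lemma M_nonneg: "0 \<le> M x"
  unfolding M_def set_lebesgue_integral_def
  by (intro Bochner_Integration.integral_nonneg) (simp add: H_nonneg)

lemma M_antimono: "x \<le> y \<Longrightarrow> M y \<le> M x"
  using tail_integral_split[OF H_integrable, of x y]
    Bochner_Integration.integral_nonneg[of "lborel" "\<lambda>t. indicator {x..y} t *\<^sub>R H t"]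
  by (simp add: M_def H_nonneg set_lebesgue_integral_def)

lemma abs_q_le: "x \<le> t \<Longrightarrow> \<bar>q t\<bar> \<le> exp (- 2 * norm z * x) * H t"
  using mult_left_mono[of x t "2 * norm z"]
    mult_left_mono[of 1 "exp (2 * norm z * t - 2 * norm z * x)" "\<bar>q t\<bar>"]
  by (simp add: H_def mult.left_commute flip: exp_add)

lemma q_integrable: "set_integrable lborel {x..} (\<lambda>t. \<bar>q t\<bar>)"
proof (rule set_integrable_dominated)
  show "set_integrable lborel {x..} (\<lambda>t. exp (- 2 * norm z * x) * H t)"
    using H_integrable by simp
qed (use abs_q_le in auto)

lemma P_nonneg: "0 \<le> P x"
  unfolding P_def set_lebesgue_integral_def
  by (intro Bochner_Integration.integral_nonneg) simp

lemma P_antimono: "x \<le> y \<Longrightarrow> P y \<le> P x"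
  using tail_integral_split[OF q_integrable, of x y]
    Bochner_Integration.integral_nonneg[of "lborel" "\<lambda>t. indicator {x..y} t *\<^sub>R \<bar>q t\<bar>"]
  by (simp add: P_def set_lebesgue_integral_def)

text \<open>Fubini will require joint measurability, which has to be carried through the recursion.
  The variable limits are absorbed into the integrand, making each kernel a parameter integral over
  the whole line.\<close>

lemma kernel_borel_pair:
  "(\<lambda>p. kernel_plus q z n (fst p) (snd p)) \<in> borel_measurable (borel \<Otimes>\<^sub>M borel)"
proof (induction n)
  case 0
  show ?case by simp
next
  case (Suc n)
  have [measurable (raw)]: "(\<lambda>p. kernel_plus q z n (f p) (g p)) \<in> borel_measurable N"
    if "f \<in> borel_measurable N" "g \<in> borel_measurable N" for f g and N :: "((real \<times> real) \<times> real) measure"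
    using measurable_compose[OF measurable_Pair[OF that] Suc.IH] by simp
  have [measurable]: "kernel_plus q z n x \<in> borel_measurable borel" for x
    using measurable_compose[OF _ Suc.IH, of "\<lambda>t. (x, t)" borel] by simp
  have "kernel_plus q z (Suc n) x t =
      (LINT s:{x..t}|lborel. kernel_plus q z n x s * of_real (q s) * kernel1 z s t)" for x t
    unfolding kernel_plus.simps by (rule set_integral_lebesgue_eq_lborel) measurable
  then have "(\<lambda>p. kernel_plus q z (Suc n) (fst p) (snd p)) = (\<lambda>p. \<integral>s. (if fst p \<le> s \<and> s \<le> snd p
      then kernel_plus q z n (fst p) s * of_real (q s) * kernel1 z s (snd p) else 0) \<partial>lborel)"
    by (auto simp: set_lebesgue_integral_def indicator_def fun_eq_iff intro!: Bochner_Integration.integral_cong)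
  also have "\<dots> \<in> borel_measurable (borel \<Otimes>\<^sub>M borel)"
    by measurable
  finally show ?case .
qed

lemma kernel_borel [measurable (raw)]:
  assumes "f \<in> borel_measurable N" "g \<in> borel_measurable N"
  shows "(\<lambda>p. kernel_plus q z n (f p) (g p)) \<in> borel_measurable N"
  using measurable_compose[OF measurable_Pair[OF assms] kernel_borel_pair] by simp

lemma kernel_Suc: "kernel_plus q z (Suc n) x t =
     (LINT s:{x..t}|lborel. kernel_plus q z n x s * of_real (q s) * kernel1 z s t)"
  unfolding kernel_plus.simps by (rule set_integral_lebesgue_eq_lborel) measurable

lemma has_density_P: "has_density (\<lambda>t. P x - P t) (\<lambda>t. \<bar>q t\<bar>)"
  using has_density_diff[OF has_density_const[of "P x"] has_density_tail[OF q_integrable]]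
  by (simp add: P_def[abs_def])

text \<open>Along x \<le> s \<le> t the exponentials multiply to exp(|z| (t - x)) exactly. What is
  left, \<open>(P x - P s) ^ n * \<bar>q s\<bar>\<close>, is up to the factor n + 1 the density of
  \<open>(P x - P s) ^ Suc n\<close>, so each iteration raises the power and extends the
  factorial.\<close>

lemma norm_kernel_le:
  assumes "x \<le> t"
  shows "norm (kernel_plus q z n x t) \<le> exp (norm z * (t - x)) * (P x - P t) ^ n / fact n"
  using assms
proof (induction n arbitrary: t)
  case 0
  then show ?case by (simp add: norm_kernel1_le)
next
  case (Suc n)
  let ?c = "exp (norm z * (t - x)) / fact (Suc n)"
  let ?g = "\<lambda>s. of_nat (Suc n) * ((P x - P s) ^ n * \<bar>q s\<bar>)"
  note dens = has_densityD[OF has_density_power[OF has_density_P] \<open>x \<le> t\<close>]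
  have "norm (kernel_plus q z (Suc n) x t) \<le> (LINT s:{x..t}|lborel. ?c * ?g s)"
    unfolding kernel_Suc
  proof (rule norm_set_integral_le)
    show "set_integrable lborel {x..t} (\<lambda>s. ?c * ?g s)"
      using dens(1) by (rule set_integrable_mult_right)
    fix s assume s: "s \<in> {x..t}"
    have "norm (kernel_plus q z n x s * of_real (q s) * kernel1 z s t) \<le>
        (exp (norm z * (s - x)) * (P x - P s) ^ n / fact n) * \<bar>q s\<bar> * exp (norm z * (t - s))"
      unfolding norm_mult using Suc.IH[of s] s norm_kernel1_le[of s t z] P_antimono[of x s]
      by (intro mult_mono) auto
    also have "\<dots> = (exp (norm z * (s - x)) * exp (norm z * (t - s))) * ((P x - P s) ^ n * \<bar>q s\<bar>) / fact n"
      by simp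
    also have "exp (norm z * (s - x)) * exp (norm z * (t - s)) = exp (norm z * (t - x))"
      by (simp add: algebra_simps flip: exp_add)
    finally show "norm (kernel_plus q z n x s * of_real (q s) * kernel1 z s t) \<le> ?c * ?g s"
      by (simp del: of_nat_Suc add: fact_Suc mult_ac)
  qed
  also have "\<dots> = ?c * (LINT s:{x..t}|lborel. ?g s)"
    by (rule set_integral_mult_right)
  also have "(LINT s:{x..t}|lborel. ?g s) = (P x - P t) ^ Suc n"
    using dens(2) by simp
  finally show ?case by simp
qed

lemma norm_ker_term_le:
  assumes "x \<le> t" "norm (f t) \<le> C * exp (norm z * t)"
  shows "norm (kernel_plus q z n x t * of_real (q t) * f t) \<le>
    (P x ^ n / fact n * (exp (- norm z * x) * C)) * H t"
proof -
  have "norm (kernel_plus q z n x t * of_real (q t) * f t) \<le>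
      (exp (norm z * (t - x)) * P x ^ n / fact n) * \<bar>q t\<bar> * (C * exp (norm z * t))"
  proof -
    have "norm (kernel_plus q z n x t) \<le> exp (norm z * (t - x)) * P x ^ n / fact n"
      using P_antimono[OF assms(1)] P_nonneg[of t]
      by (intro order_trans[OF norm_kernel_le[OF assms(1)]] divide_right_mono mult_left_mono power_mono) auto
    then show ?thesis
      unfolding norm_mult by (intro mult_mono assms(2)) (auto simp: P_nonneg)
  qed
  also have "\<dots> = (P x ^ n / fact n * C) * \<bar>q t\<bar> * (exp (norm z * (t - x)) * exp (norm z * t))"
    by simp
  also have "exp (norm z * (t - x)) * exp (norm z * t) = exp (- norm z * x) * exp (2 * norm z * t)"
    by (simp add: algebra_simps flip: exp_add)
  finally show ?thesis
    by (simp add: H_def mult_ac)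
qed

lemma growth_borel: "growth f \<Longrightarrow> f \<in> borel_measurable borel"
  by (simp add: growth_def)

lemma growthE:
  assumes "growth f"
  obtains C where "C \<ge> 0" "\<And>t. t \<ge> x \<Longrightarrow> norm (f t) \<le> C * exp (norm z * t)"
  using assms unfolding growth_def by blast

lemma growth_exp: "growth (\<lambda>t. exp (\<i> * z * zeta k * of_real t))"
  unfolding growth_def
proof (intro conjI allI)
  show "(\<lambda>t. exp (\<i> * z * zeta k * of_real t)) \<in> borel_measurable borel"
    by measurable
  fix x :: real
  have "norm (exp (\<i> * z * zeta k * of_real t)) \<le> exp (2 * norm z * \<bar>x\<bar>) * exp (norm z * t)" if "x \<le> t" for t
  proof -
    have "norm (exp (\<i> * z * zeta k * of_real t)) \<le> exp (norm z * \<bar>t\<bar>)"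
      using norm_exp_zeta_le[of k "\<i> * z * of_real t"] by (simp add: norm_mult mult_ac)
    also have "norm z * \<bar>t\<bar> \<le> norm z * (2 * \<bar>x\<bar> + t)"
      using that by (intro mult_left_mono) auto
    finally show ?thesis
      by (simp add: algebra_simps flip: exp_add)
  qed
  then show "\<exists>C\<ge>0. \<forall>t\<ge>x. norm (exp (\<i> * z * zeta k * of_real t)) \<le> C * exp (norm z * t)"
    by (intro exI[of _ "exp (2 * norm z * \<bar>x\<bar>)"]) auto
qed

lemma ker_term_integrable:
  assumes "growth f"
  shows "set_integrable lborel {x..} (\<lambda>t. kernel_plus q z n x t * of_real (q t) * f t)"
proof -
  note [measurable] = growth_borel[OF assms]
  obtain C where C: "\<And>t. t \<ge> x \<Longrightarrow> norm (f t) \<le> C * exp (norm z * t)"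
    using growthE[OF assms] by blast
  show ?thesis
  proof (rule set_integrable_dominated)
    show "set_integrable lborel {x..} (\<lambda>t. (P x ^ n / fact n * (exp (- norm z * x) * C)) * H t)"
      using H_integrable by (rule set_integrable_mult_right)
  qed (use norm_ker_term_le C in auto)
qed

lemma norm_ker_op_le:
  assumes "\<And>t. t \<ge> x \<Longrightarrow> norm (f t) \<le> C * exp (norm z * t)"
  shows "norm (ker_op n f x) \<le> P x ^ n / fact n * (exp (- norm z * x) * C) * M x"
proof -
  have "norm (ker_op n f x) \<le> (LINT t:{x..}|lborel. (P x ^ n / fact n * (exp (- norm z * x) * C)) * H t)"
    unfolding ker_op_def
    by (intro norm_set_integral_le norm_ker_term_le set_integrable_mult_right H_integrable)
      (use assms in auto)
  then show ?thesis
    by (simp only: set_integral_mult_right M_def)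
qed

text \<open>The natural bound decays in t. It is weakened to a multiple of exp(|z| t), so that
  iterates obey the same kind of bound as \<open>f\<close>, with constants that remain summable
  against powers of z.\<close>

lemma norm_ker_op_le_uniform:
  assumes "\<And>t. t \<ge> x \<Longrightarrow> norm (f t) \<le> C * exp (norm z * t)" "0 \<le> C" "x \<le> t"
  shows "norm (ker_op n f t) \<le> P x ^ n / fact n * (exp (- 2 * norm z * x) * C * M x) * exp (norm z * t)"
proof -
  have "norm (ker_op n f t) \<le> P t ^ n / fact n * (exp (- norm z * t) * C) * M t"
    using assms by (intro norm_ker_op_le) auto
  also have "\<dots> \<le> P x ^ n / fact n * ((exp (- 2 * norm z * x) * exp (norm z * t)) * C) * M x"
  proof (intro mult_mono divide_right_mono power_mono)
    show "exp (- norm z * t) \<le> exp (- 2 * norm z * x) * exp (norm z * t)"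
      using mult_left_mono[OF assms(3), of "norm z"] by (simp add: mult.commute flip: exp_add)
  qed (use P_antimono[OF assms(3)] M_antimono[OF assms(3)] P_nonneg M_nonneg assms(2) in auto)
  finally show ?thesis by (simp add: mult_ac)
qed

lemma growth_ker_op:
  assumes "growth f"
  shows "growth (ker_op n f)"
  unfolding growth_def
proof (intro conjI allI)
  note [measurable] = growth_borel[OF assms]
  have "ker_op n f = (\<lambda>x. \<integral>t. (if x \<le> t then kernel_plus q z n x t * of_real (q t) * f t else 0) \<partial>lborel)"
    by (auto simp: ker_op_def set_lebesgue_integral_def indicator_def fun_eq_iff
        intro!: Bochner_Integration.integral_cong)
  also have "\<dots> \<in> borel_measurable borel"
    by measurable
  finally show "ker_op n f \<in> borel_measurable borel" .
  fix x
  obtain C where C: "C \<ge> 0" "\<And>t. t \<ge> x \<Longrightarrow> norm (f t) \<le> C * exp (norm z * t)"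
    using growthE[OF assms] by blast
  show "\<exists>C\<ge>0. \<forall>t\<ge>x. norm (ker_op n f t) \<le> C * exp (norm z * t)"
    using norm_ker_op_le_uniform[OF C(2,1)] C(1)
    by (intro exI[of _ "P x ^ n / fact n * (exp (- 2 * norm z * x) * C * M x)"])
      (auto simp: P_nonneg M_nonneg)
qed

text \<open>Both sides integrate K(x,s) q(s) K_1(s,t) q(t) f(t) over x \<le> s \<le> t, in opposite
  orders. The majorant separates because the exponentials combine to exp(- |z| x) exp(2 |z| t): the
  whole weight falls on t, and the s part needs only an integrable q.\<close>

lemma ker_op_Suc:
  assumes "growth f"
  shows "ker_op (Suc n) f x = ker_op n (ker_op 0 f) x"
proof -
  note [measurable] = growth_borel[OF assms]
  obtain C where C: "C \<ge> 0" "\<And>t. t \<ge> x \<Longrightarrow> norm (f t) \<le> C * exp (norm z * t)"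
    using growthE[OF assms] by blast
  define F where "F s t = (if x \<le> s \<and> s \<le> t
    then kernel_plus q z n x s * of_real (q s) * kernel1 z s t * of_real (q t) * f t else 0)" for s t
  have "ker_op (Suc n) f x = (\<integral>t. \<integral>s. F s t \<partial>lborel \<partial>lborel)"
    unfolding ker_op_def set_lebesgue_integral_def
  proof (intro Bochner_Integration.integral_cong refl)
    fix t
    show "indicator {x..} t *\<^sub>R (kernel_plus q z (Suc n) x t * of_real (q t) * f t) = (\<integral>s. F s t \<partial>lborel)"
    proof (cases "x \<le> t")
      case True
      have "kernel_plus q z (Suc n) x t * (of_real (q t) * f t) =
        (\<integral>s. (indicator {x..t} s *\<^sub>R (kernel_plus q z n x s * of_real (q s) * kernel1 z s t)) * (of_real (q t) * f t) \<partial>lborel)"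
        unfolding kernel_Suc set_lebesgue_integral_def by (rule integral_mult_left_zero[symmetric])
      also have "\<dots> = (\<integral>s. F s t \<partial>lborel)"
        by (intro Bochner_Integration.integral_cong) (auto simp: F_def indicator_def)
      finally show ?thesis using True by (simp add: mult.assoc del: kernel_plus.simps)
    next
      case False
      then have "F s t = 0" for s by (auto simp: F_def)
      then show ?thesis using False by simp
    qed
  qed
  also have "\<dots> = (\<integral>s. \<integral>t. F s t \<partial>lborel \<partial>lborel)"
  proof (rule Fubini_integral_dominated)
    show "(\<lambda>(s, t). F s t) \<in> borel_measurable (lborel \<Otimes>\<^sub>M lborel)"
      unfolding F_def by measurable
    show "integrable lborel (\<lambda>s. indicator {x..} s *\<^sub>R (P x ^ n / fact n * (exp (- norm z * x) * C) * \<bar>q s\<bar>))"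
      using q_integrable[of x] unfolding set_integrable_def[symmetric] by (rule set_integrable_mult_right)
    show "integrable lborel (\<lambda>t. indicator {x..} t *\<^sub>R H t)"
      using H_integrable[of x] by (simp add: set_integrable_def)
    fix s t
    show "norm (F s t) \<le> indicator {x..} s *\<^sub>R (P x ^ n / fact n * (exp (- norm z * x) * C) * \<bar>q s\<bar>) * (indicator {x..} t *\<^sub>R H t)"
    proof (cases "x \<le> s \<and> s \<le> t")
      case True
      have "norm (F s t) = norm (kernel_plus q z n x s) * \<bar>q s\<bar> * norm (kernel1 z s t) * \<bar>q t\<bar> * norm (f t)"
        using True by (simp add: F_def norm_mult)
      also have "\<dots> \<le> (exp (norm z * (s - x)) * P x ^ n / fact n) * \<bar>q s\<bar> * exp (norm z * (t - s)) * \<bar>q t\<bar> * (C * exp (norm z * t))"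
      proof (intro mult_mono)
        show "norm (kernel_plus q z n x s) \<le> exp (norm z * (s - x)) * P x ^ n / fact n"
          using True P_antimono[of x s] P_nonneg[of s]
          by (intro order_trans[OF norm_kernel_le] divide_right_mono mult_left_mono power_mono) auto
      qed (use True C norm_kernel1_le P_nonneg in auto)
      also have "\<dots> = (P x ^ n / fact n * C * \<bar>q s\<bar>) * \<bar>q t\<bar> *
          (exp (norm z * (s - x)) * exp (norm z * (t - s)) * exp (norm z * t))"
        by simp
      also have "exp (norm z * (s - x)) * exp (norm z * (t - s)) * exp (norm z * t) = exp (- norm z * x) * exp (2 * norm z * t)"
        by (simp add: algebra_simps flip: exp_add)
      finally show ?thesis using True by (simp add: H_def mult_ac)
    next
      case False
      then have "F s t = 0" by (auto simp: F_def)
      then show ?thesis using C(1) H_nonneg[of t] P_nonneg[of x] by simp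
    qed
  qed
  also have "\<dots> = ker_op n (ker_op 0 f) x"
    unfolding ker_op_def set_lebesgue_integral_def
  proof (intro Bochner_Integration.integral_cong refl)
    fix s
    have "(\<integral>t. F s t \<partial>lborel) = (\<integral>t. (kernel_plus q z n x s * of_real (q s)) *
        (indicator {s..} t *\<^sub>R (kernel1 z s t * of_real (q t) * f t)) \<partial>lborel)" if "x \<le> s"
      using that by (intro Bochner_Integration.integral_cong) (auto simp: F_def indicator_def)
    also have "\<dots> = (kernel_plus q z n x s * of_real (q s)) *
        (\<integral>t. indicator {s..} t *\<^sub>R (kernel1 z s t * of_real (q t) * f t) \<partial>lborel)"
      by (rule integral_mult_right_zero)
    finally show "(\<integral>t. F s t \<partial>lborel) = indicator {x..} s *\<^sub>R (kernel_plus q z n x s * of_real (q s) *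
        (\<integral>t. indicator {s..} t *\<^sub>R (kernel_plus q z 0 s t * of_real (q t) * f t) \<partial>lborel))"
      by (cases "x \<le> s") (auto simp: F_def)
  qed
  finally show ?thesis .
qed

text \<open>The kernels are iterated on the right, whereas the Volterra equation needs iteration on the left.
  Since \<open>ker_op n\<close> is a power of \<open>ker_op 0\<close>, this costs no second application of Fubini.\<close>

lemma ker_op_commute:
  assumes "growth f"
  shows "ker_op 0 (ker_op n f) x = ker_op (Suc n) f x"
  using assms
proof (induction n arbitrary: f x)
  case (Suc n)
  have "ker_op (Suc n) f = ker_op n (ker_op 0 f)"
    using ker_op_Suc[OF Suc.prems] by (rule ext)
  then show ?case
    using Suc.IH[OF growth_ker_op[OF Suc.prems]] ker_op_Suc[OF Suc.prems, of "Suc n"] by simp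
qed (simp add: ker_op_Suc)

section \<open>Summation of the Neumann series\<close>

definition jost :: "(real \<Rightarrow> complex) \<Rightarrow> real \<Rightarrow> complex" where
  "jost f x = f x + (LINT t:{x..}|lborel. resolvent_plus q z x t * of_real (q t) * f t)"

lemma summable_exp_bound: "summable (\<lambda>n. norm z ^ Suc n * (P x ^ n / fact n * D))"
proof -
  have "summable (\<lambda>n. norm z * D * ((norm z * P x) ^ n /\<^sub>R fact n))"
    by (intro summable_mult summable_exp_generic)
  then show ?thesis
    by (simp add: power_mult_distrib field_simps)
qed

lemma jost_sums:
  assumes "growth f"
  shows "(\<lambda>n. (- \<i> * z) ^ Suc n * ker_op n f x) sums (jost f x - f x)"
proof -
  note [measurable] = growth_borel[OF assms]
  obtain C where C: "C \<ge> 0" "\<And>t. t \<ge> x \<Longrightarrow> norm (f t) \<le> C * exp (norm z * t)"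
    using growthE[OF assms] by blast
  let ?g = "\<lambda>n t. (- \<i> * z) ^ Suc n * (kernel_plus q z n x t * of_real (q t) * f t)"
  have "(\<lambda>n. LINT t:{x..}|lborel. ?g n t) sums (LINT t:{x..}|lborel. (\<Sum>n. ?g n t))"
  proof (rule set_integral_suminf_dominated)
    show "?g n \<in> borel_measurable borel" for n by measurable
    show "norm (?g n t) \<le> norm z ^ Suc n * (P x ^ n / fact n * (exp (- norm z * x) * C)) * H t" if "t \<in> {x..}" for n t
    proof -
      have "norm (?g n t) = norm z ^ Suc n * norm (kernel_plus q z n x t * of_real (q t) * f t)"
        by (simp only: norm_mult norm_power norm_minus_cancel norm_ii mult_1)
      also have "\<dots> \<le> norm z ^ Suc n * ((P x ^ n / fact n * (exp (- norm z * x) * C)) * H t)"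
        using that C(2) by (intro mult_left_mono norm_ker_term_le) auto
      finally show ?thesis by (simp add: mult_ac)
    qed
  qed (use summable_exp_bound H_integrable in auto)
  moreover have "(\<Sum>n. ?g n t) = resolvent_plus q z x t * of_real (q t) * f t" if "x \<le> t" for t
  proof -
    have "summable (\<lambda>n. norm z ^ Suc n * (P x ^ n / fact n * exp (norm z * (t - x))))"
      by (rule summable_exp_bound)
    then have "summable (\<lambda>n. (- \<i> * z) ^ Suc n * kernel_plus q z n x t)"
    proof (rule summable_comparison_test')
      fix n
      have "norm (kernel_plus q z n x t) \<le> exp (norm z * (t - x)) * P x ^ n / fact n"
        using that P_antimono[of x t] P_nonneg[of t]
        by (intro order_trans[OF norm_kernel_le] divide_right_mono mult_left_mono power_mono) auto
      then show "norm ((- \<i> * z) ^ Suc n * kernel_plus q z n x t) \<le> norm z ^ Suc n * (P x ^ n / fact n * exp (norm z * (t - x)))"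
        unfolding norm_mult norm_power by (intro mult_mono) (auto simp: mult_ac norm_mult)
    qed
    from suminf_mult2[OF this, of "of_real (q t) * f t"] show ?thesis
      by (simp add: resolvent_plus_def mult.assoc)
  qed
  then have "(LINT t:{x..}|lborel. (\<Sum>n. ?g n t)) = (LINT t:{x..}|lborel. resolvent_plus q z x t * of_real (q t) * f t)"
    by (intro set_lebesgue_integral_cong) auto
  moreover have "(LINT t:{x..}|lborel. ?g n t) = (- \<i> * z) ^ Suc n * ker_op n f x" for n
    by (simp only: set_integral_mult_right ker_op_def)
  ultimately show ?thesis
    by (simp add: jost_def)
qed

text \<open>Applying \<open>ker_op 0\<close> to \<open>jost f\<close> itself is legitimate only
  within \<open>growth\<close>; the uniform bounds on the iterates sum to the bound
  required.\<close>

lemma growth_jost: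
  assumes "growth f"
  shows "growth (jost f)"
  unfolding growth_def
proof (intro conjI allI)
  have [measurable]: "ker_op n f \<in> borel_measurable borel" for n
    using growth_borel[OF growth_ker_op[OF assms]] .
  note [measurable] = growth_borel[OF assms]
  have eq: "jost f x = f x + (\<Sum>n. (- \<i> * z) ^ Suc n * ker_op n f x)" for x
    using sums_unique[OF jost_sums[OF assms, of x]] by (metis add.commute diff_add_cancel)
  show "jost f \<in> borel_measurable borel"
    unfolding eq[abs_def] by measurable
  fix x
  obtain C where C: "C \<ge> 0" "\<And>t. t \<ge> x \<Longrightarrow> norm (f t) \<le> C * exp (norm z * t)"
    using growthE[OF assms, of x] by blast
  let ?a = "\<lambda>n. norm z ^ Suc n * (P x ^ n / fact n * (exp (- 2 * norm z * x) * C * M x))"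
  have "norm (jost f t) \<le> (C + (\<Sum>n. ?a n)) * exp (norm z * t)" if "x \<le> t" for t
  proof -
    have "norm (\<Sum>n. (- \<i> * z) ^ Suc n * ker_op n f t) \<le> (\<Sum>n. ?a n * exp (norm z * t))"
    proof (rule norm_suminf_le)
      fix n
      have "norm ((- \<i> * z) ^ Suc n * ker_op n f t) = norm z ^ Suc n * norm (ker_op n f t)"
        by (simp only: norm_mult norm_power norm_minus_cancel norm_ii mult_1)
      also have "\<dots> \<le> norm z ^ Suc n * (P x ^ n / fact n * (exp (- 2 * norm z * x) * C * M x) * exp (norm z * t))"
        using norm_ker_op_le_uniform[OF C(2) C(1) that, of n] by (intro mult_left_mono) auto
      finally show "norm ((- \<i> * z) ^ Suc n * ker_op n f t) \<le> ?a n * exp (norm z * t)"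
        by (simp only: mult.assoc)
    qed (intro summable_mult2 summable_exp_bound)
    also have "\<dots> = (\<Sum>n. ?a n) * exp (norm z * t)"
      by (rule suminf_mult2[symmetric]) (rule summable_exp_bound)
    finally show ?thesis
      using norm_triangle_mono[OF C(2)[OF that]] unfolding eq by (simp add: distrib_right)
  qed
  moreover have "0 \<le> C + (\<Sum>n. ?a n)"
    using C(1) by (intro add_nonneg_nonneg suminf_nonneg summable_exp_bound)
      (auto simp: P_nonneg M_nonneg)
  ultimately show "\<exists>C\<ge>0. \<forall>t\<ge>x. norm (jost f t) \<le> C * exp (norm z * t)"
    by blast
qed

text \<open>Applying \<open>ker_op 0\<close> to the series shifts its index by one, through
  \<open>ker_op_commute\<close>. Multiplied by - i z and completed by the term for n = 0, the
  shifted series is the original one.\<close>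

lemma jost_integral_equation:
  assumes "growth f"
  shows "jost f x = f x - \<i> * z * ker_op 0 (jost f) x"
proof -
  note [measurable] = growth_borel[OF assms]
  have [measurable]: "ker_op n f \<in> borel_measurable borel" for n
    using growth_borel[OF growth_ker_op[OF assms]] .
  obtain C where C: "C \<ge> 0" "\<And>t. t \<ge> x \<Longrightarrow> norm (f t) \<le> C * exp (norm z * t)"
    using growthE[OF assms, of x] by blast
  let ?h = "\<lambda>n t. (- \<i> * z) ^ Suc n * ker_op n f t"
  let ?D = "exp (- 2 * norm z * x) * C * M x"
  let ?a = "\<lambda>n. norm z ^ Suc n * (P x ^ n / fact n * ?D)"
  have h_le: "norm (?h n t) \<le> ?a n * exp (norm z * t)" if "x \<le> t" for n t
  proof -
    have "norm (?h n t) = norm z ^ Suc n * norm (ker_op n f t)"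
      by (simp only: norm_mult norm_power norm_minus_cancel norm_ii mult_1)
    also have "\<dots> \<le> norm z ^ Suc n * (P x ^ n / fact n * ?D * exp (norm z * t))"
      using norm_ker_op_le_uniform[OF C(2) C(1) that, of n] by (intro mult_left_mono) auto
    finally show ?thesis by (simp only: mult.assoc)
  qed
  let ?g = "\<lambda>n t. kernel_plus q z 0 x t * of_real (q t) * ?h n t"
  have "(\<lambda>n. LINT t:{x..}|lborel. ?g n t) sums (LINT t:{x..}|lborel. (\<Sum>n. ?g n t))"
  proof (rule set_integral_suminf_dominated)
    show "?g n \<in> borel_measurable borel" for n by measurable
    show "norm (?g n t) \<le> ?a n * (exp (- norm z * x) * H t)" if "t \<in> {x..}" for n t
      using norm_ker_term_le[of x t "?h n" "?a n" 0] h_le[of t n] that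
      by (simp del: kernel_plus.simps add: mult_ac)
  qed (use summable_exp_bound H_integrable in auto)
  moreover have "(\<Sum>n. ?g n t) = kernel_plus q z 0 x t * of_real (q t) * (jost f t - f t)" for t
    using sums_unique[OF sums_mult[OF jost_sums[OF assms]]] by metis
  moreover have "(LINT t:{x..}|lborel. ?g n t) = (- \<i> * z) ^ Suc n * ker_op (Suc n) f x" for n
  proof -
    have "?g n = (\<lambda>t. (- \<i> * z) ^ Suc n * (kernel_plus q z 0 x t * of_real (q t) * ker_op n f t))"
      by (simp add: mult_ac fun_eq_iff)
    then show ?thesis
      using ker_op_commute[OF assms, of n x] by (simp only: set_integral_mult_right ker_op_def)
  qed
  ultimately have "(\<lambda>n. (- \<i> * z) ^ Suc n * ker_op (Suc n) f x) sums
      (LINT t:{x..}|lborel. kernel_plus q z 0 x t * of_real (q t) * (jost f t - f t))"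
    by simp
  also have "(LINT t:{x..}|lborel. kernel_plus q z 0 x t * of_real (q t) * (jost f t - f t)) =
      ker_op 0 (jost f) x - ker_op 0 f x"
    unfolding ker_op_def right_diff_distrib
    by (intro set_integral_diff ker_term_integrable growth_jost assms)
  finally have "(\<lambda>n. (- \<i> * z) * ((- \<i> * z) ^ Suc n * ker_op (Suc n) f x)) sums
      (- \<i> * z * (ker_op 0 (jost f) x - ker_op 0 f x))"
    by (rule sums_mult)
  then have "(\<lambda>n. (- \<i> * z) ^ Suc (Suc n) * ker_op (Suc n) f x) sums
      (- \<i> * z * (ker_op 0 (jost f) x - ker_op 0 f x))"
    by (simp add: mult.assoc)
  then have "(\<lambda>n. (- \<i> * z) ^ Suc n * ker_op n f x) sums
      (- \<i> * z * (ker_op 0 (jost f) x - ker_op 0 f x) + (- \<i> * z) ^ Suc 0 * ker_op 0 f x)"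
    by (rule sums_Suc)
  from sums_unique2[OF jost_sums[OF assms] this] show ?thesis
    by (simp add: algebra_simps)
qed

end

section \<open>Jost solutions solve the differential equation\<close>

lemma has_density_sum:
  fixes f :: "'i \<Rightarrow> real \<Rightarrow> 'a::{banach,second_countable_topology}"
  assumes "finite I" "\<And>i. i \<in> I \<Longrightarrow> has_density (F i) (f i)"
  shows "has_density (\<lambda>x. \<Sum>i\<in>I. F i x) (\<lambda>x. \<Sum>i\<in>I. f i x)"
  using assms by (induction I) (auto intro: has_density_const has_density_add)

lemma set_integral_sum:
  fixes f :: "'i \<Rightarrow> real \<Rightarrow> 'a::{banach,second_countable_topology}"
  assumes "finite I" "\<And>i. i \<in> I \<Longrightarrow> set_integrable M A (f i)"
  shows "set_integrable M A (\<lambda>x. \<Sum>i\<in>I. f i x) \<and>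
    (LINT x:A|M. (\<Sum>i\<in>I. f i x)) = (\<Sum>i\<in>I. LINT x:A|M. f i x)"
  using assms
  by (induction I) (auto simp: set_integral_add, simp_all add: set_integrable_def set_lebesgue_integral_def)

lemma has_density_exp:
  fixes c :: complex
  shows "has_density (\<lambda>x. exp (c * of_real x)) (\<lambda>x. c * exp (c * of_real x))"
proof (rule has_density_of_deriv)
  fix x :: real
  have "((\<lambda>w. exp (c * w)) has_field_derivative c * exp (c * of_real x)) (at (of_real x))"
    by (auto intro!: derivative_eq_intros)
  then show "((\<lambda>x. exp (c * of_real x)) has_vector_derivative c * exp (c * of_real x)) (at x)"
    by (rule has_vector_derivative_real_field)
qed (intro continuous_intros)

text \<open>\<open>Y\<close> holds y, y', y'' as separate functions linked by densities. The
  equation i y''' = m lambda^3 y corresponds to c = - i lambda^3.\<close>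

definition solves :: "complex \<Rightarrow> (real \<Rightarrow> real) \<Rightarrow> (nat \<Rightarrow> real \<Rightarrow> complex) \<Rightarrow> bool" where
  "solves c m Y \<longleftrightarrow> has_density (Y 0) (Y 1) \<and> has_density (Y 1) (Y 2) \<and>
     has_density (Y 2) (\<lambda>x. c * of_real (m x) * Y 0 x)"

definition jost_asymp :: "complex \<Rightarrow> complex \<Rightarrow> (nat \<Rightarrow> real \<Rightarrow> complex) \<Rightarrow> bool" where
  "jost_asymp \<kappa> w Y \<longleftrightarrow>
     (\<forall>n. ((\<lambda>x. of_real (exp (norm \<kappa> * x)) * (Y n x - (\<kappa> * w) ^ n * exp (\<kappa> * w * of_real x))) \<longlongrightarrow> 0) at_top)"

context jost_problem
begin

lemma M_tendsto_0: "(M \<longlongrightarrow> 0) at_top"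
proof -
  have "((\<lambda>y. M 0 - (LINT t:{0..y}|lborel. H t)) \<longlongrightarrow> M 0 - M 0) at_top"
    unfolding M_def
    by (intro tendsto_intros tendsto_set_lebesgue_integral_at_top H_integrable) auto
  moreover have "\<forall>\<^sub>F y in at_top. M 0 - (LINT t:{0..y}|lborel. H t) = M y"
    using eventually_ge_at_top[of 0]
    by eventually_elim (simp add: M_def tail_integral_split[OF H_integrable])
  ultimately show ?thesis
    by (auto elim: Lim_transform_eventually)
qed

abbreviation wave :: "nat \<Rightarrow> real \<Rightarrow> complex" where
  "wave k t \<equiv> exp (\<i> * z * zeta k * of_real t)"

text \<open>One of the three exponentials of \<open>s2\<close> taken alone. Unlike the full kernel
  it factors into a function of x and a function of t, so the product rule yields a first-order
  linear equation for it.\<close>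

definition tail_wave :: "nat \<Rightarrow> nat \<Rightarrow> real \<Rightarrow> complex" where
  "tail_wave k j x = (LINT t:{x..}|lborel. exp (\<i> * z * zeta j * of_real (x - t)) * of_real (q t) * jost (wave k) t)"

lemma norm_tail_wave_term_le:
  assumes "x \<le> t" "norm (f t) \<le> C * exp (norm z * t)"
  shows "norm (exp (\<i> * z * zeta j * of_real (x - t)) * of_real (q t) * f t) \<le> exp (- norm z * x) * C * H t"
proof -
  have "norm (exp (\<i> * z * zeta j * of_real (x - t))) \<le> exp (norm z * (t - x))"
    using norm_exp_zeta_le[of j "\<i> * z * of_real (x - t)"] assms(1)
    by (simp add: norm_mult mult_ac flip: of_real_diff)
  then have "norm (exp (\<i> * z * zeta j * of_real (x - t)) * of_real (q t) * f t) \<le>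
      exp (norm z * (t - x)) * \<bar>q t\<bar> * (C * exp (norm z * t))"
    unfolding norm_mult by (intro mult_mono assms(2)) auto
  also have "\<dots> = C * \<bar>q t\<bar> * (exp (norm z * (t - x)) * exp (norm z * t))"
    by simp
  also have "exp (norm z * (t - x)) * exp (norm z * t) = exp (- norm z * x) * exp (2 * norm z * t)"
    by (simp add: algebra_simps flip: exp_add)
  finally show ?thesis
    by (simp add: H_def mult_ac)
qed

lemma tail_wave_integrable:
  "set_integrable lborel {x..} (\<lambda>t. exp (\<i> * z * zeta j * of_real (x - t)) * of_real (q t) * jost (wave k) t)"
proof -
  note g = growth_jost[OF growth_exp[of k]]
  note [measurable] = growth_borel[OF g]
  obtain C where C: "\<And>t. t \<ge> x \<Longrightarrow> norm (jost (wave k) t) \<le> C * exp (norm z * t)"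
    using growthE[OF g] by blast
  show ?thesis
  proof (rule set_integrable_dominated)
    show "set_integrable lborel {x..} (\<lambda>t. exp (- norm z * x) * C * H t)"
      using H_integrable by (rule set_integrable_mult_right)
  qed (use norm_tail_wave_term_le C in auto)
qed

lemma exp_wave_split:
  "exp (\<i> * z * zeta j * of_real (x - t)) * a * b =
    exp (\<i> * z * zeta j * of_real x) * (exp (- (\<i> * z * zeta j * of_real t)) * a * b)"
  by (simp add: algebra_simps exp_diff exp_minus divide_inverse)

lemma has_density_tail_wave:
  "has_density (tail_wave k j)
    (\<lambda>x. \<i> * z * zeta j * tail_wave k j x - of_real (q x) * jost (wave k) x)"
proof -
  let ?g = "\<lambda>t. exp (- (\<i> * z * zeta j * of_real t)) * of_real (q t) * jost (wave k) t"
  have "set_integrable lborel {x..} ?g" for x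
  proof -
    have "set_integrable lborel {x..} (\<lambda>t. exp (- (\<i> * z * zeta j * of_real x)) *
        (exp (\<i> * z * zeta j * of_real (x - t)) * of_real (q t) * jost (wave k) t))"
      using tail_wave_integrable by (rule set_integrable_mult_right)
    then show ?thesis
      by (simp only: exp_wave_split mult.assoc[symmetric] flip: exp_add) simp
  qed
  note dens = has_density_mult[OF has_density_exp[of "\<i> * z * zeta j"] has_density_tail[OF this]]
  have tw: "tail_wave k j x = exp (\<i> * z * zeta j * of_real x) * (LINT t:{x..}|lborel. ?g t)" for x
    by (simp only: tail_wave_def exp_wave_split set_integral_mult_right)
  have "exp (\<i> * z * zeta j * of_real x) * ?g x = of_real (q x) * jost (wave k) x" for x
    by (simp only: mult.assoc[symmetric] flip: exp_add) simp
  then have "exp (\<i> * z * zeta j * of_real x) * - ?g x = - (of_real (q x) * jost (wave k) x)" for x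
    by (simp only: mult_minus_right)
  moreover have "\<i> * z * zeta j * exp (\<i> * z * zeta j * of_real x) * (LINT t:{x..}|lborel. ?g t) =
      \<i> * z * zeta j * tail_wave k j x" for x
    by (simp only: tw mult.assoc)
  ultimately show ?thesis
    using dens by (simp only: tw[symmetric] add_uminus_conv_diff)
qed

text \<open>Once exp(- |z| x) is factored out, a multiple of \<open>M x\<close> remains, the tail of
  a convergent integral. This is the source of the little-o in the Jost asymptotics.\<close>

lemma tail_wave_tendsto_0: "((\<lambda>x. of_real (exp (norm z * x)) * tail_wave k j x) \<longlongrightarrow> 0) at_top"
proof -
  obtain C where C: "C \<ge> 0" "\<And>t. t \<ge> 0 \<Longrightarrow> norm (jost (wave k) t) \<le> C * exp (norm z * t)"
    using growthE[OF growth_jost[OF growth_exp[of k]]] by blast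
  show ?thesis
  proof (rule Lim_null_comparison)
    show "((\<lambda>x. C * M x) \<longlongrightarrow> 0) at_top"
      using tendsto_mult_right_zero[OF M_tendsto_0] .
    show "\<forall>\<^sub>F x in at_top. norm (of_real (exp (norm z * x)) * tail_wave k j x) \<le> C * M x"
      using eventually_ge_at_top[of 0]
    proof eventually_elim
      case (elim x)
      have "norm (tail_wave k j x) \<le> (LINT t:{x..}|lborel. exp (- norm z * x) * C * H t)"
        unfolding tail_wave_def
        by (intro norm_set_integral_le norm_tail_wave_term_le set_integrable_mult_right H_integrable)
          (use elim C in auto)
      also have "\<dots> = exp (- norm z * x) * C * M x"
        by (simp only: set_integral_mult_right M_def)
      finally have "exp (norm z * x) * norm (tail_wave k j x) \<le> exp (norm z * x) * (exp (- norm z * x) * C * M x)"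
        by (intro mult_left_mono) auto
      also have "\<dots> = C * M x"
        by (simp only: mult.assoc[symmetric] flip: exp_add) simp
      finally show ?case
        by (simp add: norm_mult)
    qed
  qed
qed

text \<open>Differentiating under the integral multiplies the three exponentials of \<open>s2\<close> by \<open>\<i> * z * zeta j\<close>,
  and \<open>zeta j powi (-2) = zeta j\<close>. The boundary terms vanish for \<open>n = 0, 1\<close> because
  the power sums of the cube roots of unity do.\<close>

definition jost_deriv :: "nat \<Rightarrow> nat \<Rightarrow> real \<Rightarrow> complex" where
  "jost_deriv k n x = (\<i> * z * zeta k) ^ n * wave k x
     - (\<i> * z) ^ Suc n / 3 * (\<Sum>j<3. zeta j ^ Suc n * tail_wave k j x)"

lemma jost_deriv_0: "jost_deriv k 0 = jost (wave k)"
proof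
  fix x
  have "ker_op 0 (jost (wave k)) x =
      (LINT t:{x..}|lborel. (1 / 3) * (\<Sum>j<3. zeta j * (exp (\<i> * z * zeta j * of_real (x - t)) * of_real (q t) * jost (wave k) t)))"
    unfolding ker_op_def by (simp add: kernel1_def s2_eq sum_distrib_left sum_distrib_right sum_divide_distrib mult_ac)
  also have "\<dots> = (1 / 3) * (\<Sum>j<3. zeta j * tail_wave k j x)"
    unfolding tail_wave_def set_integral_mult_right
    by (subst set_integral_sum[THEN conjunct2])
      (auto intro!: tail_wave_integrable set_integrable_mult_right simp only: set_integral_mult_right)
  finally show "jost_deriv k 0 x = jost (wave k) x"
    using jost_integral_equation[OF growth_exp, of k x] by (simp add: jost_deriv_def)
qed

lemma has_density_jost_deriv:
  "has_density (jost_deriv k n)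
    (\<lambda>x. jost_deriv k (Suc n) x + (\<i> * z) ^ Suc n / 3 * (\<Sum>j<3. zeta j ^ Suc n) * (of_real (q x) * jost (wave k) x))"
proof -
  have "has_density (jost_deriv k n)
    (\<lambda>x. (\<i> * z * zeta k) ^ n * (\<i> * z * zeta k * wave k x) - (\<i> * z) ^ Suc n / 3 *
      (\<Sum>j<3. zeta j ^ Suc n * (\<i> * z * zeta j * tail_wave k j x - of_real (q x) * jost (wave k) x)))"
    unfolding jost_deriv_def[abs_def]
    by (intro has_density_diff has_density_cmult has_density_sum has_density_exp has_density_tail_wave) auto
  then show ?thesis
    by (rule back_subst[where P = "has_density (jost_deriv k n)"])
      (simp add: jost_deriv_def fun_eq_iff eval_nat_numeral field_simps)
qed

text \<open>Since \<open>zeta j ^ 3 = 1\<close>, the formula for \<open>jost_deriv\<close> at index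
  3 is kappa^3 times the one at index 0. The boundary term for n = 2 carries the power sum 3 and
  contributes exactly the missing kappa^3 q y.\<close>

lemma solves_jost_deriv: "solves ((\<i> * z) ^ 3) (\<lambda>x. 1 + q x) (jost_deriv k)"
proof -
  have s: "(\<Sum>j<3. zeta j ^ Suc 0) = 0" "(\<Sum>j<3. zeta j ^ Suc 1) = 0" "(\<Sum>j<3. zeta j ^ Suc 2) = 3"
    using sum_zeta zeta_cube by (simp_all add: numeral_2_eq_2 numeral_3_eq_3)
  have j3: "jost_deriv k 3 x = (\<i> * z) ^ 3 * jost (wave k) x" for x
  proof -
    have "zeta j ^ Suc 3 = zeta j" for j
      by (simp only: power_Suc zeta_cube mult_1_right)
    then have "jost_deriv k 3 x = (\<i> * z) ^ 3 * wave k x - (\<i> * z) ^ 3 * (\<i> * z) / 3 * (\<Sum>j<3. zeta j * tail_wave k j x)"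
      by (simp only: jost_deriv_def power_mult_distrib[of "\<i> * z"] zeta_cube power_Suc2[of "\<i> * z"] mult_1_right)
    moreover have "jost (wave k) x = wave k x - \<i> * z / 3 * (\<Sum>j<3. zeta j * tail_wave k j x)"
      using fun_cong[OF jost_deriv_0[of k], of x] by (simp add: jost_deriv_def)
    ultimately show ?thesis
      by (simp only: right_diff_distrib) simp
  qed
  have "has_density (jost_deriv k 2) (\<lambda>x. (\<i> * z) ^ 3 * of_real (1 + q x) * jost_deriv k 0 x)"
  proof -
    have "jost_deriv k (Suc 2) x + (\<i> * z) ^ Suc 2 / 3 * 3 * (of_real (q x) * jost (wave k) x) =
        (\<i> * z) ^ 3 * of_real (1 + q x) * jost_deriv k 0 x" for x
      using j3[of x] by (simp add: jost_deriv_0 distrib_left distrib_right)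
    then show ?thesis
      using has_density_jost_deriv[of k 2] unfolding s by simp
  qed
  then show ?thesis
    using has_density_jost_deriv[of k 0] has_density_jost_deriv[of k 1] unfolding s solves_def
    by (simp add: numeral_2_eq_2)
qed

lemma jost_asymp_jost_deriv: "jost_asymp (\<i> * z) (zeta k) (jost_deriv k)"
  unfolding jost_asymp_def
proof
  fix n
  have "((\<lambda>x. - ((\<i> * z) ^ Suc n / 3) * (\<Sum>j<3. zeta j ^ Suc n * (of_real (exp (norm z * x)) * tail_wave k j x))) \<longlongrightarrow>
      - ((\<i> * z) ^ Suc n / 3) * (\<Sum>j<3::nat. zeta j ^ Suc n * 0)) at_top"
    by (intro tendsto_intros tail_wave_tendsto_0)
  then show "((\<lambda>x. of_real (exp (norm (\<i> * z) * x)) *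
      (jost_deriv k n x - (\<i> * z * zeta k) ^ n * exp (\<i> * z * zeta k * of_real x))) \<longlongrightarrow> 0) at_top"
    by (simp add: jost_deriv_def norm_mult sum_distrib_left sum_negf mult_ac)
qed

end

section \<open>Invariant forms and their limits\<close>

text \<open>The Lagrange bracket. It is constant if \<open>Y\<close> solves the equation at \<open>lam\<close> and \<open>W\<close> at \<open>cnj lam\<close>.\<close>

definition bform :: "(nat \<Rightarrow> real \<Rightarrow> complex) \<Rightarrow> (nat \<Rightarrow> real \<Rightarrow> complex) \<Rightarrow> real \<Rightarrow> complex" where
  "bform Y W x = Y 2 x * cnj (W 0 x) - Y 1 x * cnj (W 1 x) + Y 0 x * cnj (W 2 x)"

definition jet_matrix :: "(nat \<Rightarrow> nat \<Rightarrow> real \<Rightarrow> complex) \<Rightarrow> real \<Rightarrow> complex ^ 3 ^ 3" where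
  "jet_matrix Y x = vector [vector [Y 0 0 x, Y 0 1 x, Y 0 2 x],
     vector [Y 1 0 x, Y 1 1 x, Y 1 2 x], vector [Y 2 0 x, Y 2 1 x, Y 2 2 x]]"

text \<open>The matrix of the Lagrange bracket on jets (y, y', y''); it turns the nine brackets of
  two triples into one matrix product.\<close>

definition S_mat :: "complex ^ 3 ^ 3" where
  "S_mat = vector [vector [0, 0, 1], vector [0, - 1, 0], vector [1, 0, 0]]"

definition jost_system :: "complex \<Rightarrow> (real \<Rightarrow> real) \<Rightarrow> complex \<Rightarrow> (nat \<Rightarrow> nat \<Rightarrow> real \<Rightarrow> complex) \<Rightarrow> bool" where
  "jost_system c m \<kappa> Y \<longleftrightarrow> (\<forall>k<3. solves c m (Y k) \<and> jost_asymp \<kappa> (zeta k) (Y k))"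

lemma jet_matrix_form:
  "jet_matrix Y x ** S_mat ** conj_transpose (jet_matrix W x) =
    vector [vector [bform (Y 0) (W 0) x, bform (Y 0) (W 1) x, bform (Y 0) (W 2) x],
      vector [bform (Y 1) (W 0) x, bform (Y 1) (W 1) x, bform (Y 1) (W 2) x],
      vector [bform (Y 2) (W 0) x, bform (Y 2) (W 1) x, bform (Y 2) (W 2) x]]"
  by (simp add: vec_eq_iff forall_3 matrix_matrix_mult_def sum_3 jet_matrix_def S_mat_def
      conj_transpose_def bform_def)

text \<open>In the density the mixed terms cancel in pairs; c m y conj(w) meets its counterpart from
  w with opposite sign because m is real. For c = - i lambda^3 the partner \<open>- cnj c\<close> is
  the coefficient belonging to conj(lambda).\<close>

lemma bform_const:
  assumes Y: "solves c m Y" and W: "solves (- cnj c) m W"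
  shows "bform Y W x = bform Y W y"
proof -
  let ?C = "\<lambda>n x. cnj (W n x)"
  have C: "has_density (?C 0) (?C 1)" "has_density (?C 1) (?C 2)"
    "has_density (?C 2) (\<lambda>x. cnj (- cnj c * of_real (m x) * W 0 x))"
    using W unfolding solves_def by (blast intro: has_density_cnj, blast intro: has_density_cnj, metis has_density_cnj)
  have "has_density (bform Y W) (\<lambda>x.
      (c * of_real (m x) * Y 0 x * ?C 0 x + Y 2 x * ?C 1 x)
      - (Y 2 x * ?C 1 x + Y 1 x * ?C 2 x)
      + (Y 1 x * ?C 2 x + Y 0 x * cnj (- cnj c * of_real (m x) * W 0 x)))"
    unfolding bform_def[abs_def]
    using Y C by (intro has_density_add has_density_diff has_density_mult) (auto simp: solves_def)
  then show ?thesis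
    by (intro has_density_zero_const) simp
qed

text \<open>Liouville's formula with trace zero, as the equation has no y'' term. It is carried out
  on the six products of the expanded determinant, whose densities cancel.\<close>

lemma det_jet_matrix_const:
  assumes "\<And>k. k < 3 \<Longrightarrow> solves c m (Y k)"
  shows "det (jet_matrix Y x) = det (jet_matrix Y y)"
proof -
  let ?d = "\<lambda>k x. c * of_real (m x) * Y k 0 x"
  let ?W = "\<lambda>i j k x. Y i 0 x * (Y j 1 x * Y k 2 x)"
  have dens: "has_density (?W i j k)
      (\<lambda>x. Y i 1 x * (Y j 1 x * Y k 2 x) + Y i 0 x * (Y j 2 x * Y k 2 x + Y j 1 x * ?d k x))"
    if "i < 3" "j < 3" "k < 3" for i j k
    using assms[OF that(1)] assms[OF that(2)] assms[OF that(3)]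
    by (intro has_density_mult) (auto simp: solves_def)
  have "has_density (\<lambda>x. ?W 0 1 2 x + ?W 1 2 0 x + ?W 2 0 1 x - ?W 0 2 1 x - ?W 1 0 2 x - ?W 2 1 0 x)
    (\<lambda>x. (Y 0 1 x * (Y 1 1 x * Y 2 2 x) + Y 0 0 x * (Y 1 2 x * Y 2 2 x + Y 1 1 x * ?d 2 x))
      + (Y 1 1 x * (Y 2 1 x * Y 0 2 x) + Y 1 0 x * (Y 2 2 x * Y 0 2 x + Y 2 1 x * ?d 0 x))
      + (Y 2 1 x * (Y 0 1 x * Y 1 2 x) + Y 2 0 x * (Y 0 2 x * Y 1 2 x + Y 0 1 x * ?d 1 x))
      - (Y 0 1 x * (Y 2 1 x * Y 1 2 x) + Y 0 0 x * (Y 2 2 x * Y 1 2 x + Y 2 1 x * ?d 1 x))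
      - (Y 1 1 x * (Y 0 1 x * Y 2 2 x) + Y 1 0 x * (Y 0 2 x * Y 2 2 x + Y 0 1 x * ?d 2 x))
      - (Y 2 1 x * (Y 1 1 x * Y 0 2 x) + Y 2 0 x * (Y 1 2 x * Y 0 2 x + Y 1 1 x * ?d 0 x)))"
    by (intro has_density_add has_density_diff dens) auto
  then have "has_density (\<lambda>x. ?W 0 1 2 x + ?W 1 2 0 x + ?W 2 0 1 x - ?W 0 2 1 x - ?W 1 0 2 x - ?W 2 1 0 x) (\<lambda>x. 0)"
    by (simp add: algebra_simps)
  moreover have "det (jet_matrix Y x) = ?W 0 1 2 x + ?W 1 2 0 x + ?W 2 0 1 x - ?W 0 2 1 x - ?W 1 0 2 x - ?W 2 1 0 x" for x
    by (simp add: det_3 jet_matrix_def)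
  ultimately show ?thesis
    using has_density_zero_const by simp
qed

section \<open>Asymptotic evaluation of the forms\<close>

lemma norm_exp_linear_le:
  fixes \<kappa> :: complex
  assumes "norm w \<le> 1" "0 \<le> x"
  shows "norm (exp (\<kappa> * w * of_real x)) \<le> exp (norm \<kappa> * x)"
proof -
  have "norm (\<kappa> * w * of_real x) \<le> norm \<kappa> * x"
    using assms mult_right_mono[of "norm w" 1 "norm \<kappa> * x"]
    by (simp add: norm_mult mult.assoc mult.left_commute)
  then show ?thesis
    using norm_exp[of "\<kappa> * w * of_real x"] by (meson exp_le_cancel_iff order_trans)
qed

lemma tendsto_0_exp_mult:
  fixes E \<sigma> :: "real \<Rightarrow> complex"
  assumes "((\<lambda>x. of_real (exp (r * x)) * \<sigma> x) \<longlongrightarrow> 0) at_top"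
    and "\<And>x. 0 \<le> x \<Longrightarrow> norm (E x) \<le> exp (r * x)"
  shows "((\<lambda>x. E x * \<sigma> x) \<longlongrightarrow> 0) at_top"
proof (rule Lim_null_comparison)
  show "((\<lambda>x. norm (of_real (exp (r * x)) * \<sigma> x)) \<longlongrightarrow> 0) at_top"
    using assms(1) by (rule tendsto_norm_zero)
  show "\<forall>\<^sub>F x in at_top. norm (E x * \<sigma> x) \<le> norm (of_real (exp (r * x)) * \<sigma> x)"
    using eventually_ge_at_top[of 0]
    by eventually_elim (auto simp: norm_mult intro!: mult_right_mono assms(2))
qed

lemma tendsto_0_of_exp:
  fixes \<sigma> :: "real \<Rightarrow> complex"
  assumes "((\<lambda>x. of_real (exp (r * x)) * \<sigma> x) \<longlongrightarrow> 0) at_top" "0 \<le> r"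
  shows "(\<sigma> \<longlongrightarrow> 0) at_top"
  using tendsto_0_exp_mult[OF assms(1), of "\<lambda>_. 1"] assms(2) by simp

text \<open>Each factor is a wave plus an error. Wave times error vanishes by the weighted decay,
  error times error all the more, and the wave products add up to a^2 - a b + b^2 times one
  exponential, with rates a = kappa w and b = - kappa conj(w').\<close>

lemma bform_asymp:
  assumes Y: "jost_asymp \<kappa> w Y" and W: "jost_asymp \<kappa>' w' W"
    and \<kappa>: "cnj \<kappa>' = - \<kappa>" and w: "norm w \<le> 1" "norm w' \<le> 1"
  shows "((\<lambda>x. bform Y W x - \<kappa>\<^sup>2 * (w\<^sup>2 + w * cnj w' + (cnj w')\<^sup>2) * exp (\<kappa> * (w - cnj w') * of_real x)) \<longlongrightarrow> 0) at_top"
proof -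
  define r where "r = norm \<kappa>"
  have r': "norm \<kappa>' = r"
    using \<kappa> by (metis r_def complex_mod_cnj norm_minus_cancel)
  define a where "a = \<kappa> * w"
  define b where "b = - (\<kappa> * cnj w')"
  define E where "E x = exp (\<kappa> * w * of_real x)" for x :: real
  define F where "F x = exp (- \<kappa> * cnj w' * of_real x)" for x :: real
  define \<rho> where "\<rho> n x = Y n x - a ^ n * E x" for n x
  define \<sigma> where "\<sigma> n x = cnj (W n x) - b ^ n * F x" for n x
  have E: "norm (E x) \<le> exp (r * x)" and F: "norm (F x) \<le> exp (r * x)" if "0 \<le> x" for x
    using norm_exp_linear_le[OF w(1) that, of \<kappa>] norm_exp_linear_le[of "cnj w'" x "- \<kappa>"] w(2) that
    by (simp_all add: E_def F_def r_def)
  have \<rho>: "((\<lambda>x. of_real (exp (r * x)) * \<rho> n x) \<longlongrightarrow> 0) at_top" for n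
    using Y by (simp add: jost_asymp_def \<rho>_def a_def E_def r_def)
  have \<sigma>: "((\<lambda>x. of_real (exp (r * x)) * \<sigma> n x) \<longlongrightarrow> 0) at_top" for n
  proof -
    have "((\<lambda>x. of_real (exp (norm \<kappa>' * x)) * (W n x - (\<kappa>' * w') ^ n * exp (\<kappa>' * w' * of_real x))) \<longlongrightarrow> 0) at_top"
      using W by (simp add: jost_asymp_def)
    from tendsto_cnj[OF this] show ?thesis
      by (simp add: r' \<sigma>_def b_def F_def exp_cnj \<kappa>)
  qed
  note \<rho>0 = tendsto_0_of_exp[OF \<rho>] and \<sigma>0 = tendsto_0_of_exp[OF \<sigma>]
  have r0: "0 \<le> r" by (simp add: r_def)
  have "((\<lambda>x. a^2 * (E x * \<sigma> 0 x) + F x * \<rho> 2 x + \<rho> 2 x * \<sigma> 0 x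
      - (a * (E x * \<sigma> 1 x) + b * (F x * \<rho> 1 x) + \<rho> 1 x * \<sigma> 1 x)
      + (E x * \<sigma> 2 x + b^2 * (F x * \<rho> 0 x) + \<rho> 0 x * \<sigma> 2 x)) \<longlongrightarrow>
      a^2 * 0 + 0 + 0 * 0 - (a * 0 + b * 0 + 0 * 0) + (0 + b^2 * 0 + 0 * 0)) at_top"
    by (intro tendsto_intros tendsto_0_exp_mult[OF \<sigma> E] tendsto_0_exp_mult[OF \<rho> F] \<rho>0 \<sigma>0 r0)
  moreover have "bform Y W x - \<kappa>\<^sup>2 * (w\<^sup>2 + w * cnj w' + (cnj w')\<^sup>2) * exp (\<kappa> * (w - cnj w') * of_real x) =
      a^2 * (E x * \<sigma> 0 x) + F x * \<rho> 2 x + \<rho> 2 x * \<sigma> 0 x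
      - (a * (E x * \<sigma> 1 x) + b * (F x * \<rho> 1 x) + \<rho> 1 x * \<sigma> 1 x)
      + (E x * \<sigma> 2 x + b^2 * (F x * \<rho> 0 x) + \<rho> 0 x * \<sigma> 2 x)" for x
  proof -
    have Y: "Y n x = a ^ n * E x + \<rho> n x" and W: "cnj (W n x) = b ^ n * F x + \<sigma> n x" for n
      by (simp_all add: \<rho>_def \<sigma>_def)
    have "\<kappa>\<^sup>2 * (w\<^sup>2 + w * cnj w' + (cnj w')\<^sup>2) = a^2 - a * b + b^2"
      by (simp add: a_def b_def power2_eq_square algebra_simps)
    moreover have "exp (\<kappa> * (w - cnj w') * of_real x) = E x * F x"
      by (simp add: E_def F_def algebra_simps flip: exp_add)
    ultimately show ?thesis
      by (simp only: bform_def Y W) (simp add: power2_eq_square algebra_simps)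
  qed
  ultimately show ?thesis
    by simp
qed

text \<open>The leading exponential need not converge, but (w - conj(w')) (w^2 + w conj(w') +
  conj(w')^2) = w^3 - conj(w'^3) = 0: either its exponent or its coefficient is zero. A limit
  therefore exists, and the constant bracket equals it everywhere.\<close>

lemma bform_jost:
  assumes Y: "jost_asymp \<kappa> w Y" "solves c m Y" and W: "jost_asymp \<kappa>' w' W" "solves (- cnj c) m W"
    and \<kappa>: "cnj \<kappa>' = - \<kappa>" and w: "w ^ 3 = 1" "w' ^ 3 = 1"
  shows "bform Y W x = (if w = cnj w' then 3 * \<kappa>\<^sup>2 * w\<^sup>2 else 0)"
proof -
  have n: "norm u \<le> 1" if "u ^ 3 = 1" for u :: complex
  proof -
    have "norm u ^ 3 = 1"
      using that by (simp flip: norm_power)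
    then show ?thesis
      using power_eq_imp_eq_base[of "norm u" 3 1] by simp
  qed
  define L where "L = (if w = cnj w' then 3 * \<kappa>\<^sup>2 * w\<^sup>2 else 0)"
  have "\<kappa>\<^sup>2 * (w\<^sup>2 + w * cnj w' + (cnj w')\<^sup>2) * exp (\<kappa> * (w - cnj w') * of_real y) = L" for y
  proof (cases "w = cnj w'")
    case True
    then show ?thesis by (simp add: L_def power2_eq_square)
  next
    case False
    have "(w - cnj w') * (w\<^sup>2 + w * cnj w' + (cnj w')\<^sup>2) = w ^ 3 - cnj (w' ^ 3)"
      by (simp add: power2_eq_square power3_eq_cube algebra_simps)
    then have "w\<^sup>2 + w * cnj w' + (cnj w')\<^sup>2 = 0"
      using False w by simp
    then show ?thesis using False by (simp add: L_def)
  qed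
  with bform_asymp[OF Y(1) W(1) \<kappa> n[OF w(1)] n[OF w(2)]] have "((\<lambda>y. bform Y W y - L) \<longlongrightarrow> 0) at_top"
    by simp
  moreover have "(\<lambda>y. bform Y W y - L) = (\<lambda>y. bform Y W x - L)"
    using bform_const[OF Y(2) W(2)] by metis
  ultimately have "((\<lambda>y::real. bform Y W x - L) \<longlongrightarrow> 0) at_top"
    by simp
  then show ?thesis
    by (simp add: tendsto_const_iff L_def)
qed

lemma cnj_zeta: "cnj (zeta 0) = zeta 0" "cnj (zeta 1) = zeta 2" "cnj (zeta 2) = zeta 1"
  by (simp_all add: zeta_def)

lemma zeta_square: "(zeta 0)\<^sup>2 = 1" "(zeta 1)\<^sup>2 = zeta 2" "(zeta 2)\<^sup>2 = zeta 1"
  using zeta_sqrt3 by (simp_all add: zeta_def power2_eq_square field_simps)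

lemma zeta_distinct: "zeta 0 \<noteq> zeta 1" "zeta 0 \<noteq> zeta 2" "zeta 1 \<noteq> zeta 2"
  "zeta 1 \<noteq> zeta 0" "zeta 2 \<noteq> zeta 0" "zeta 2 \<noteq> zeta 1"
  by (auto simp: zeta_def complex_eq_iff)

text \<open>Conjugation fixes \<open>zeta 0\<close> and exchanges \<open>zeta 1\<close> with
  \<open>zeta 2\<close>, which places the nonzero brackets where J has its nonzero entries; the
  values are the squares zeta_k^2, namely 1, zeta_2, zeta_1.\<close>

lemma jost_system_form:
  assumes Y: "jost_system c m \<kappa> Y" and W: "jost_system (- cnj c) m \<kappa>' W" and \<kappa>: "cnj \<kappa>' = - \<kappa>"
  shows "jet_matrix Y x ** S_mat ** conj_transpose (jet_matrix W x) = mat (3 * \<kappa>\<^sup>2) ** J_mat"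
proof -
  have "bform (Y k) (W l) x = (if zeta k = cnj (zeta l) then 3 * \<kappa>\<^sup>2 * (zeta k)\<^sup>2 else 0)" if "k < 3" "l < 3" for k l
    using Y W that by (intro bform_jost[OF _ _ _ _ \<kappa> zeta_cube zeta_cube]) (auto simp: jost_system_def)
  then show ?thesis
    unfolding jet_matrix_form J_mat_def vec_eq_iff forall_3
    by (simp add: matrix_matrix_mult_def mat_def sum_3 cnj_zeta zeta_square zeta_distinct flip: One_nat_def)
qed

lemma J_mat_square: "J_mat ** J_mat = mat 1"
proof -
  have "zeta 2 * zeta 1 = 1" "zeta 1 * zeta 2 = 1"
    using zeta_cube[of 1] zeta_square(2) by (simp_all add: power3_eq_cube power2_eq_square mult_ac)
  then show ?thesis
    by (simp add: vec_eq_iff forall_3 matrix_matrix_mult_def sum_3 J_mat_def mat_def)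
qed

text \<open>A direct limit fails: two waves times one error is only known to be o(exp(|kappa| x)).
  Dividing each row by its own wave cures this, and leaves the determinant unchanged because the
  three exponents sum to zero.\<close>

lemma det_jost_system:
  assumes Y: "jost_system c m \<kappa> Y"
  shows "det (jet_matrix Y x) = \<kappa> ^ 3 * det (jet_matrix (\<lambda>k n x. zeta k ^ n) 0)"
proof -
  define N where "N k n x = exp (- \<kappa> * zeta k * of_real x) * Y k n x" for k n x
  have det_N: "det (jet_matrix N y) = det (jet_matrix Y y)" for y
  proof -
    have "- \<kappa> * zeta 0 * of_real y + - \<kappa> * zeta 1 * of_real y + - \<kappa> * zeta 2 * of_real y
        = - \<kappa> * (\<Sum>j<3. zeta j) * of_real y"
      by (simp add: eval_nat_numeral algebra_simps)
    then have "exp (- \<kappa> * zeta 0 * of_real y) * exp (- \<kappa> * zeta 1 * of_real y) * exp (- \<kappa> * zeta 2 * of_real y) = 1"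
      unfolding sum_zeta by (simp only: exp_add[symmetric]) simp
    moreover have "det (jet_matrix N y) = (exp (- \<kappa> * zeta 0 * of_real y) * exp (- \<kappa> * zeta 1 * of_real y) *
        exp (- \<kappa> * zeta 2 * of_real y)) * det (jet_matrix Y y)"
      unfolding det_3 jet_matrix_def vector_3 N_def by algebra
    ultimately show ?thesis by simp
  qed
  have N: "(N k n \<longlongrightarrow> (\<kappa> * zeta k) ^ n) at_top" if "k < 3" for k n
  proof -
    have e: "exp (- \<kappa> * zeta k * of_real x) * ((\<kappa> * zeta k) ^ n * exp (\<kappa> * zeta k * of_real x)) = (\<kappa> * zeta k) ^ n" for x
      by (simp add: exp_minus)
    have "((\<lambda>x. exp (- \<kappa> * zeta k * of_real x) * (Y k n x - (\<kappa> * zeta k) ^ n * exp (\<kappa> * zeta k * of_real x))) \<longlongrightarrow> 0) at_top"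
    proof (rule tendsto_0_exp_mult)
      show "((\<lambda>x. of_real (exp (norm \<kappa> * x)) * (Y k n x - (\<kappa> * zeta k) ^ n * exp (\<kappa> * zeta k * of_real x))) \<longlongrightarrow> 0) at_top"
        using Y that unfolding jost_system_def jost_asymp_def by blast
      show "norm (exp (- \<kappa> * zeta k * of_real x)) \<le> exp (norm \<kappa> * x)" if "0 \<le> x" for x
        using norm_exp_linear_le[of "zeta k" x "- \<kappa>"] that by simp
    qed
    then have "((\<lambda>x. (N k n x - (\<kappa> * zeta k) ^ n) + (\<kappa> * zeta k) ^ n) \<longlongrightarrow> 0 + (\<kappa> * zeta k) ^ n) at_top"
      unfolding N_def right_diff_distrib e by (intro tendsto_add tendsto_const)
    then show ?thesis by simp
  qed
  have "((\<lambda>y. det (jet_matrix N y)) \<longlongrightarrow> det (jet_matrix (\<lambda>k n x. (\<kappa> * zeta k) ^ n) 0)) at_top"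
    unfolding det_3 jet_matrix_def vector_3 by (intro tendsto_intros N) auto
  moreover have "det (jet_matrix N y) = det (jet_matrix Y x)" for y
    unfolding det_N using Y by (intro det_jet_matrix_const) (auto simp: jost_system_def)
  moreover have "det (jet_matrix (\<lambda>k n x. (\<kappa> * zeta k) ^ n) 0) = \<kappa> ^ 3 * det (jet_matrix (\<lambda>k n x. zeta k ^ n) 0)"
    unfolding det_3 jet_matrix_def vector_3 by algebra
  ultimately show ?thesis
    by (simp add: tendsto_const_iff)
qed

section \<open>The transition matrix\<close>

lemma mat_mult_nth:
  fixes A :: "'a::comm_semiring_1 ^ 'm ^ 'n"
  shows "(mat a ** A) $ i $ j = a * A $ i $ j" "(A ** mat a) $ i $ j = a * A $ i $ j"
proof -
  have "(\<Sum>k\<in>UNIV. (if i = k then a else 0) * A $ k $ j) = (\<Sum>k\<in>UNIV. if i = k then a * A $ k $ j else 0)"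
    by (rule sum.cong) auto
  then show "(mat a ** A) $ i $ j = a * A $ i $ j"
    by (simp add: matrix_matrix_mult_def mat_def)
  have "(\<Sum>k\<in>UNIV. A $ i $ k * (if k = j then a else 0)) = (\<Sum>k\<in>UNIV. if k = j then a * A $ i $ k else 0)"
    by (rule sum.cong) (auto simp: mult.commute)
  then show "(A ** mat a) $ i $ j = a * A $ i $ j"
    by (simp add: matrix_matrix_mult_def mat_def)
qed

lemma mat_mult_commute:
  fixes A :: "'a::comm_semiring_1 ^ 'n ^ 'n"
  shows "mat a ** A = A ** mat a"
  by (simp add: vec_eq_iff mat_mult_nth)

lemma mat_mult_mat: "mat a ** mat b = (mat (a * b) :: 'a::comm_semiring_1 ^ 'n ^ 'n)"
  unfolding vec_eq_iff mat_mult_nth by (simp add: mat_def mult.commute)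

lemma conj_transpose_mult: "conj_transpose (A ** B) = conj_transpose B ** conj_transpose A"
  by (simp add: vec_eq_iff conj_transpose_def matrix_matrix_mult_def mult.commute)

section \<open>Reflection, uniqueness and algebra of the transition matrix\<close>

definition reflect :: "(nat \<Rightarrow> nat \<Rightarrow> real \<Rightarrow> complex) \<Rightarrow> nat \<Rightarrow> nat \<Rightarrow> real \<Rightarrow> complex" where
  "reflect Y k n x = (- 1) ^ n * Y k n (- x)"

lemma solves_reflect:
  assumes "solves c m (Y k)"
  shows "solves (- c) (\<lambda>x. m (- x)) (reflect Y k)"
proof -
  have "has_density (\<lambda>x. - 1 * Y k 1 (- x)) (\<lambda>x. - 1 * - Y k 2 (- x))"
    using assms by (intro has_density_cmult has_density_reflect) (simp add: solves_def)
  moreover have "has_density (\<lambda>x. Y k 0 (- x)) (\<lambda>x. - Y k 1 (- x))"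
    using assms by (intro has_density_reflect) (simp add: solves_def)
  moreover have "has_density (\<lambda>x. Y k 2 (- x)) (\<lambda>x. - (c * of_real (m (- x)) * Y k 0 (- x)))"
    using assms by (intro has_density_reflect[of "Y k 2"]) (simp add: solves_def)
  ultimately show ?thesis
    by (simp add: solves_def reflect_def[abs_def])
qed

text \<open>Every term of the bracket has total derivative order 2, so the signs cancel. The
  determinant has total order 3, whence the sign in \<open>det_reflect\<close>.\<close>

lemma reflect_form:
  "jet_matrix (reflect Y) x ** S_mat ** conj_transpose (jet_matrix (reflect W) x) =
    jet_matrix Y (- x) ** S_mat ** conj_transpose (jet_matrix W (- x))"
  by (simp add: jet_matrix_form bform_def reflect_def)

lemma det_reflect: "det (jet_matrix (reflect Y) x) = - det (jet_matrix Y (- x))"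
  by (simp add: det_3 jet_matrix_def reflect_def)

lemma has_density_zero_imp_zero:
  fixes f :: "real \<Rightarrow> 'a::euclidean_space"
  assumes "has_density (\<lambda>x. 0) f" "continuous_on UNIV f"
  shows "f x = 0"
  using has_density_imp_deriv[OF assms, of x] has_vector_derivative_const[of 0 "at x"]
  by (rule vector_derivative_unique_at)

text \<open>A linear relation among the functions passes to the first two derivatives, all
  continuous, so \<open>D\<close> annihilates an invertible jet matrix. This is the uniqueness
  behind the definite description \<open>transition_matrix\<close>.\<close>

lemma jet_matrix_kernel_trivial:
  fixes D :: "complex ^ 3 ^ 3"
  assumes V: "\<And>k. k < 3 \<Longrightarrow> solves c m (V k)"
    and det: "det (jet_matrix V 0) \<noteq> 0"
    and zero: "\<And>x. D *v vector [V 0 0 x, V 1 0 x, V 2 0 x] = 0"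
  shows "D = 0"
proof -
  have "D ** jet_matrix V 0 = 0"
  proof -
    define Z where "Z i n x = D $ i $ 1 * V 0 n x + D $ i $ 2 * V 1 n x + D $ i $ 3 * V 2 n x" for i n x
    have d: "has_density (Z i 0) (Z i 1)" "has_density (Z i 1) (Z i 2)"
      "has_density (Z i 2) (\<lambda>x. D $ i $ 1 * (c * of_real (m x) * V 0 0 x)
        + D $ i $ 2 * (c * of_real (m x) * V 1 0 x) + D $ i $ 3 * (c * of_real (m x) * V 2 0 x))" for i
      unfolding Z_def[abs_def] using V[of 0] V[of 1] V[of 2]
      by (auto intro!: has_density_add has_density_cmult simp: solves_def)
    have Z0: "Z i 0 = (\<lambda>x. 0)" for i
      using zero by (auto simp: Z_def fun_eq_iff vec_eq_iff matrix_vector_mult_def sum_3)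
    have Z1: "Z i 1 = (\<lambda>x. 0)" for i
      using has_density_zero_imp_zero[of "Z i 1"] d(1)[of i] has_density_continuous_on[OF d(2)]
      unfolding Z0 by blast
    have Z2: "Z i 2 = (\<lambda>x. 0)" for i
      using has_density_zero_imp_zero[of "Z i 2"] d(2)[of i] has_density_continuous_on[OF d(3)]
      unfolding Z1 by blast
    have "Z i n 0 = 0" if "n \<in> {0, 1, 2}" for i n
      using that Z0[of i] Z1[of i] Z2[of i] by auto
    then show ?thesis
      by (simp add: vec_eq_iff forall_3 matrix_matrix_mult_def sum_3 jet_matrix_def Z_def)
  qed
  moreover obtain B where "jet_matrix V 0 ** B = mat 1"
    using det unfolding invertible_det_nz[symmetric] invertible_def by blast
  ultimately have "D ** mat 1 = 0 ** B"
    by (metis matrix_mul_assoc)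
  then show ?thesis
    by (simp add: matrix_matrix_mult_def vec_eq_iff mat_def if_distrib cong: if_cong)
qed

lemma transition_matrix_eq:
  assumes V: "\<And>k. k < 3 \<Longrightarrow> solves c m' (V k)" "det (jet_matrix V 0) \<noteq> 0"
    and plus: "\<And>k x. V k 0 x = jost_plus m mp k lam x"
    and minus: "\<And>k x. U k 0 x = jost_minus m mm k lam x"
    and T: "\<And>x. jet_matrix U x = T ** jet_matrix V x"
  shows "transition_matrix m mp mm lam = T"
  unfolding transition_matrix_def
proof (rule the_equality)
  let ?v = "\<lambda>x. vector [V 0 0 x, V 1 0 x, V 2 0 x] :: complex ^ 3"
  have v: "jost_plus_col m mp lam x = ?v x" for x
    by (simp add: jost_plus_col_def plus)
  show *: "\<forall>x. jost_minus_col m mm lam x = T *v jost_plus_col m mp lam x"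
  proof
    fix x
    show "jost_minus_col m mm lam x = T *v jost_plus_col m mp lam x"
      using T[of x] unfolding v jost_minus_col_def minus[symmetric]
      by (simp add: vec_eq_iff forall_3 matrix_matrix_mult_def matrix_vector_mult_def sum_3 jet_matrix_def)
  qed
  fix T' assume "\<forall>x. jost_minus_col m mm lam x = T' *v jost_plus_col m mp lam x"
  with * have "(T' - T) *v ?v x = 0" for x
    unfolding v by (simp add: matrix_vector_mult_diff_rdistrib)
  with V have "T' - T = 0"
    by (rule jet_matrix_kernel_trivial)
  then show "T' = T" by simp
qed

text \<open>The constant form makes \<open>S_mat ** conj_transpose V' ** J_mat\<close> a multiple of the inverse of \<open>V\<close>, so that
  solutions are expanded in the Jost basis without a uniqueness theorem for the initial value problem.\<close>

lemma transition_exists: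
  fixes V V' U C :: "complex ^ 3 ^ 3"
  assumes V: "V ** S_mat ** conj_transpose V' = mat \<alpha> ** J_mat" and \<alpha>: "\<alpha> \<noteq> 0"
    and U: "U ** S_mat ** conj_transpose V' = C"
  shows "U = (C ** J_mat ** mat (1 / \<alpha>)) ** V"
proof -
  let ?R = "S_mat ** conj_transpose V' ** J_mat ** mat (1 / \<alpha>)"
  have "V ** ?R = mat \<alpha> ** (J_mat ** J_mat) ** mat (1 / \<alpha>)"
    using V by (simp add: matrix_mul_assoc)
  also have "\<dots> = mat 1"
    using \<alpha> by (simp add: J_mat_square mat_mult_mat)
  finally have "?R ** V = mat 1"
    by (simp add: matrix_left_right_inverse)
  then have "U = U ** (?R ** V)"
    by simp
  also have "\<dots> = (C ** J_mat ** mat (1 / \<alpha>)) ** V"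
    unfolding U[symmetric] by (simp add: matrix_mul_assoc)
  finally show ?thesis .
qed

text \<open>Inserting U = T V and U' = T' V' places the Gram matrix of V and V' between T and the
  adjoint of T'.\<close>

lemma transition_J_unitary:
  fixes V V' U U' T T' :: "complex ^ 3 ^ 3"
  assumes V: "V ** S_mat ** conj_transpose V' = mat \<alpha> ** J_mat" and \<alpha>: "\<alpha> \<noteq> 0"
    and U: "U ** S_mat ** conj_transpose U' = mat \<beta> ** J_mat"
    and T: "U = T ** V" "U' = T' ** V'"
  shows "T ** J_mat ** conj_transpose T' = mat (\<beta> / \<alpha>) ** J_mat"
proof -
  have "mat \<beta> ** J_mat = T ** (V ** S_mat ** conj_transpose V') ** conj_transpose T'"
    unfolding U[symmetric] T conj_transpose_mult by (simp add: matrix_mul_assoc)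
  also have "\<dots> = mat \<alpha> ** (T ** J_mat ** conj_transpose T')"
    unfolding V by (simp add: matrix_mul_assoc mat_mult_commute[of \<alpha> T])
  finally have "mat (1 / \<alpha>) ** (mat \<beta> ** J_mat) = mat (1 / \<alpha>) ** (mat \<alpha> ** (T ** J_mat ** conj_transpose T'))"
    by simp
  then show ?thesis
    using \<alpha> by (simp add: matrix_mul_assoc mat_mult_mat)
qed

section \<open>Jost solutions at both ends\<close>

text \<open>Normalising by the limit leaves no trace in the equation: (i lambda n_+)^3 m / m_+ = - i
  lambda^3 m. Solutions from both ends thus satisfy one equation, and their brackets can be
  compared.\<close>

lemma plus_system:
  assumes m: "m \<in> borel_measurable borel" and mp: "0 < mp"
    and weight: "\<And>x. set_integrable lborel {x..}
      (\<lambda>t. (m t / mp - 1) * exp (2 * norm (lam * of_real (root 3 mp)) * t))"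
  obtains V where "jost_system (- \<i> * lam ^ 3) m (\<i> * (lam * of_real (root 3 mp))) V"
    "\<And>k x. V k 0 x = jost_plus m mp k lam x"
proof -
  let ?q = "\<lambda>t. m t / mp - 1" and ?z = "lam * of_real (root 3 mp)"
  interpret jost_problem ?q ?z
    using m weight by unfold_locales auto
  have "(\<i> * ?z) ^ 3 * of_real (1 + ?q x) = - \<i> * lam ^ 3 * of_real (m x)" for x
  proof -
    have "complex_of_real (root 3 mp) ^ 3 = of_real mp"
      using mp by (simp add: real_root_pow_pos2 flip: of_real_power)
    then show ?thesis
      using mp by (simp add: power_mult_distrib power3_eq_cube[of \<i>])
  qed
  then have "solves (- \<i> * lam ^ 3) m (jost_deriv k)" for k
    using solves_jost_deriv[of k] by (simp only: solves_def)
  then have "jost_system (- \<i> * lam ^ 3) m (\<i> * ?z) jost_deriv"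
    using jost_asymp_jost_deriv by (simp add: jost_system_def)
  moreover have "jost_deriv k 0 x = jost_plus m mp k lam x" for k x
  proof -
    have [measurable]: "resolvent_plus ?q ?z x \<in> borel_measurable borel"
      unfolding resolvent_plus_def[abs_def] by measurable
    show ?thesis
      unfolding jost_deriv_0 jost_def jost_plus_def Let_def
      using m by (subst set_integral_lebesgue_eq_lborel) auto
  qed
  ultimately show thesis
    by (rule that)
qed

lemma set_integral_reflect:
  fixes f :: "real \<Rightarrow> complex"
  assumes "f \<in> borel_measurable borel" "A \<in> sets borel"
  shows "(LINT t:A|lebesgue. f t) = (LINT t:uminus ` A|lebesgue. f (- t))"
proof -
  have [measurable]: "f \<in> borel_measurable borel" by fact
  have A: "uminus ` A = uminus -` A"
    by force
  have "uminus -` A \<inter> space borel \<in> sets borel"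
    by (rule measurable_sets[OF _ assms(2)]) measurable
  then have "uminus ` A \<in> sets borel"
    by (simp add: A)
  then have "(LINT t:uminus ` A|lebesgue. f (- t)) = (LINT t:uminus ` A|lborel. f (- t))"
    using assms(1) by (intro set_integral_lebesgue_eq_lborel) auto
  also have "\<dots> = (\<integral>t. indicator A (0 + - 1 * t) *\<^sub>R f (0 + - 1 * t) \<partial>lborel)"
    unfolding set_lebesgue_integral_def A by (simp add: indicator_def)
  also have "\<dots> = (LINT t:A|lborel. f t)"
    unfolding set_lebesgue_integral_def by (subst (2) lborel_integral_real_affine[of "- 1" _ 0]) simp_all
  finally show ?thesis
    using set_integral_lebesgue_eq_lborel[OF assms] by simp
qed

text \<open>The argument i z (x - t) is unchanged when z, x and t all change sign. Passing to - z
  also reconciles the opposite signs in the two resolvent series.\<close>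

lemma (in jost_problem) kernel_minus_reflect:
  "kernel_minus (\<lambda>t. q (- t)) (- z) n x t = kernel_plus q z n (- x) (- t)"
proof (induction n arbitrary: t)
  case 0
  show ?case by (simp add: kernel1_def algebra_simps)
next
  case (Suc n)
  have k1: "kernel1 (- z) s t = kernel1 z (- s) (- t)" for s t
    by (simp add: kernel1_def algebra_simps)
  have "uminus ` {t..x} = {- x..- t}"
    by simp
  moreover have "(\<lambda>s. kernel_plus q z n (- x) (- s) * of_real (q (- s)) * kernel1 z (- s) (- t)) \<in> borel_measurable borel"
    by measurable
  ultimately show ?case
    unfolding kernel_minus.simps kernel_plus.simps Suc.IH k1
    by (subst set_integral_reflect) simp_all
qed

text \<open>The wave too is unchanged when z and x change sign, so u_k for m at lambda is v_k for
  the reflected coefficient at - lambda. The second claim serves the passage to a Borel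
  representative.\<close>

lemma jost_minus_reflect:
  assumes m: "m \<in> borel_measurable borel"
    and weight: "\<And>x. set_integrable lborel {x..}
      (\<lambda>t. (m (- t) / mm - 1) * exp (2 * norm (lam * of_real (root 3 mm)) * t))"
  shows "jost_minus m mm k lam x = jost_plus (\<lambda>x. m (- x)) mm k (- lam) (- x)"
    and "kernel_minus (\<lambda>t. m t / mm - 1) (lam * of_real (root 3 mm)) n y \<in> borel_measurable borel"
proof -
  let ?q = "\<lambda>t. m (- t) / mm - 1" and ?z = "- (lam * of_real (root 3 mm))"
  interpret jost_problem ?q ?z
    using m weight by unfold_locales auto
  have k: "kernel_minus (\<lambda>t. m t / mm - 1) (lam * of_real (root 3 mm)) n y t = kernel_plus ?q ?z n (- y) (- t)" for n y t
    using kernel_minus_reflect[of n y t] by simp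
  show "kernel_minus (\<lambda>t. m t / mm - 1) (lam * of_real (root 3 mm)) n y \<in> borel_measurable borel"
    unfolding k[abs_def] by measurable
  have r: "resolvent_minus (\<lambda>t. m t / mm - 1) (lam * of_real (root 3 mm)) y t = resolvent_plus ?q ?z (- y) (- t)" for y t
    by (simp add: resolvent_minus_def resolvent_plus_def k)
  have [measurable]: "(\<lambda>t. resolvent_plus ?q ?z y (- t)) \<in> borel_measurable borel" for y
    unfolding resolvent_plus_def by measurable
  have "uminus ` {..x} = {- x..}"
    by simp
  moreover have "(\<lambda>t. resolvent_plus ?q ?z (- x) (- t) * of_real (m t / mm - 1) *
      exp (\<i> * (lam * of_real (root 3 mm)) * zeta k * of_real t)) \<in> borel_measurable borel"
    using m by measurable
  ultimately show "jost_minus m mm k lam x = jost_plus (\<lambda>x. m (- x)) mm k (- lam) (- x)"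
    unfolding jost_minus_def jost_plus_def Let_def r by (subst set_integral_reflect) simp_all
qed

section \<open>Passage to a Borel representative of m\<close>

lemma set_integral_cong_AE_factor:
  fixes g h :: "real \<Rightarrow> complex"
  assumes q: "q \<in> borel_measurable lebesgue" "q' \<in> borel_measurable borel" "AE t in lebesgue. q t = q' t"
    and g: "g \<in> borel_measurable borel" "h \<in> borel_measurable borel" and A: "A \<in> sets borel"
  shows "(LINT t:A|lebesgue. g t * of_real (q t) * h t) = (LINT t:A|lebesgue. g t * of_real (q' t) * h t)"
proof -
  have [measurable]: "q \<in> borel_measurable lebesgue" by fact
  have [measurable]: "g \<in> borel_measurable lebesgue" "h \<in> borel_measurable lebesgue" "q' \<in> borel_measurable lebesgue"
    "A \<in> sets lebesgue"
    using q g A by (auto intro: measurable_completion)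
  show ?thesis
    unfolding set_lebesgue_integral_def
  proof (rule integral_cong_AE)
    show "AE t in lebesgue. indicator A t *\<^sub>R (g t * of_real (q t) * h t) = indicator A t *\<^sub>R (g t * of_real (q' t) * h t)"
      using q(3) by eventually_elim simp
  qed measurable
qed

text \<open>Equality holds at every point, not just almost everywhere: the initial kernel does not
  involve q, and each further one uses q only under an integral.\<close>

lemma kernel_plus_cong_AE:
  assumes q: "q \<in> borel_measurable lebesgue" "q' \<in> borel_measurable borel" "AE t in lebesgue. q t = q' t"
    and meas: "\<And>n x. kernel_plus q' z n x \<in> borel_measurable borel"
  shows "kernel_plus q z n x t = kernel_plus q' z n x t"
proof (induction n arbitrary: t)
  case (Suc n)
  have "(\<lambda>s. kernel1 z s t) \<in> borel_measurable borel"
    by measurable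
  then show ?case
    by (simp add: Suc.IH set_integral_cong_AE_factor[OF q meas])
qed simp

lemma kernel_minus_cong_AE:
  assumes q: "q \<in> borel_measurable lebesgue" "q' \<in> borel_measurable borel" "AE t in lebesgue. q t = q' t"
    and meas: "\<And>n x. kernel_minus q' z n x \<in> borel_measurable borel"
  shows "kernel_minus q z n x t = kernel_minus q' z n x t"
proof (induction n arbitrary: t)
  case (Suc n)
  have "(\<lambda>s. kernel1 z s t) \<in> borel_measurable borel"
    by measurable
  then show ?case
    by (simp add: Suc.IH set_integral_cong_AE_factor[OF q meas])
qed simp

lemma jost_plus_cong_AE:
  assumes m: "m \<in> borel_measurable lebesgue" "m' \<in> borel_measurable borel" "AE t in lebesgue. m t = m' t"
    and weight: "\<And>x. set_integrable lborel {x..}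
      (\<lambda>t. (m' t / mp - 1) * exp (2 * norm (lam * of_real (root 3 mp)) * t))"
  shows "jost_plus m mp k lam x = jost_plus m' mp k lam x"
proof -
  let ?q = "\<lambda>t. m t / mp - 1" and ?q' = "\<lambda>t. m' t / mp - 1" and ?z = "lam * of_real (root 3 mp)"
  interpret jost_problem ?q' ?z
    using m weight by unfold_locales auto
  have q: "?q \<in> borel_measurable lebesgue" "?q' \<in> borel_measurable borel" "AE t in lebesgue. ?q t = ?q' t"
    using m by auto
  have "kernel_plus ?q ?z n x t = kernel_plus ?q' ?z n x t" for n x t
    by (rule kernel_plus_cong_AE[OF q]) measurable
  then have r: "resolvent_plus ?q ?z x t = resolvent_plus ?q' ?z x t" for x t
    by (simp add: resolvent_plus_def)
  have "resolvent_plus ?q' ?z x \<in> borel_measurable borel"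
    unfolding resolvent_plus_def[abs_def] by measurable
  then show ?thesis
    unfolding jost_plus_def Let_def r by (subst set_integral_cong_AE_factor[OF q]) auto
qed

lemma jost_minus_cong_AE:
  assumes m: "m \<in> borel_measurable lebesgue" "m' \<in> borel_measurable borel" "AE t in lebesgue. m t = m' t"
    and weight: "\<And>x. set_integrable lborel {x..}
      (\<lambda>t. (m' (- t) / mm - 1) * exp (2 * norm (lam * of_real (root 3 mm)) * t))"
  shows "jost_minus m mm k lam x = jost_minus m' mm k lam x"
proof -
  let ?q = "\<lambda>t. m t / mm - 1" and ?q' = "\<lambda>t. m' t / mm - 1" and ?z = "lam * of_real (root 3 mm)"
  have q: "?q \<in> borel_measurable lebesgue" "?q' \<in> borel_measurable borel" "AE t in lebesgue. ?q t = ?q' t"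
    using m by auto
  note meas [measurable] = jost_minus_reflect(2)[OF m(2) weight]
  have "kernel_minus ?q ?z n x t = kernel_minus ?q' ?z n x t" for n x t
    by (rule kernel_minus_cong_AE[OF q meas])
  then have r: "resolvent_minus ?q ?z x t = resolvent_minus ?q' ?z x t" for x t
    by (simp add: resolvent_minus_def)
  have "resolvent_minus ?q' ?z x \<in> borel_measurable borel"
    unfolding resolvent_minus_def[abs_def] by measurable
  then show ?thesis
    unfolding jost_minus_def Let_def r by (subst set_integral_cong_AE_factor[OF q]) auto
qed

text \<open>\<open>U\<close> stays on the reflected line because asymptotics are formulated at plus
  infinity only; \<open>reflect\<close> brings it back. The sign of the coefficient, from (-
  lambda)^3, is undone by \<open>solves_reflect\<close>.\<close>

lemma jost_data:
  assumes m: "m \<in> borel_measurable lebesgue" "m' \<in> borel_measurable borel" "AE t in lebesgue. m t = m' t"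
    and mp: "0 < mp" and mm: "0 < mm"
    and weight_plus: "\<And>x. set_integrable lborel {x..}
      (\<lambda>t. (m' t / mp - 1) * exp (2 * norm (lam * of_real (root 3 mp)) * t))"
    and weight_minus: "\<And>x. set_integrable lborel {x..}
      (\<lambda>t. (m' (- t) / mm - 1) * exp (2 * norm (lam * of_real (root 3 mm)) * t))"
  obtains V U where
    "jost_system (- \<i> * lam ^ 3) m' (\<i> * (lam * of_real (root 3 mp))) V"
    "jost_system (\<i> * lam ^ 3) (\<lambda>x. m' (- x)) (- \<i> * (lam * of_real (root 3 mm))) U"
    "\<And>k x. V k 0 x = jost_plus m mp k lam x"
    "\<And>k x. reflect U k 0 x = jost_minus m mm k lam x"
proof -
  obtain V where V: "jost_system (- \<i> * lam ^ 3) m' (\<i> * (lam * of_real (root 3 mp))) V"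
    "\<And>k x. V k 0 x = jost_plus m' mp k lam x"
    using plus_system[OF m(2) mp weight_plus] by blast
  have "(\<lambda>x. m' (- x)) \<in> borel_measurable borel"
    using m(2) by measurable
  then obtain U where U: "jost_system (- \<i> * (- lam) ^ 3) (\<lambda>x. m' (- x)) (\<i> * (- lam * of_real (root 3 mm))) U"
    "\<And>k x. U k 0 x = jost_plus (\<lambda>x. m' (- x)) mm k (- lam) x"
    using plus_system[of "\<lambda>x. m' (- x)" mm "- lam"] mm weight_minus by auto
  show thesis
  proof (rule that)
    show "V k 0 x = jost_plus m mp k lam x" for k x
      using V(2) jost_plus_cong_AE[OF m weight_plus] by simp
    show "reflect U k 0 x = jost_minus m mm k lam x" for k x
      using U(2) jost_minus_cong_AE[OF m weight_minus] jost_minus_reflect(1)[OF m(2) weight_minus]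
      by (simp add: reflect_def)
    show "jost_system (\<i> * lam ^ 3) (\<lambda>x. m' (- x)) (- \<i> * (lam * of_real (root 3 mm))) U"
      using U(1) by simp
  qed (rule V(1))
qed

section \<open>Weighted integrability from the square-integrability hypothesis\<close>

lemma set_integrable_exp_neg:
  assumes "0 < (c::real)"
  shows "set_integrable lborel {x..} (\<lambda>t. exp (- c * t))"
proof -
  have "set_integrable lebesgue {x..} (\<lambda>t. exp (- c * t))"
    using assms by (intro nonnegative_absolutely_integrable_1 integrable_on_exp_minus_to_infinity) auto
  then show ?thesis
    unfolding set_integrable_def by (subst (asm) integrable_completion) auto
qed

text \<open>On the half-line, |m - m_+| exp(2 r t) is the product of |m - m_+| exp(a t) and exp((2 r
  - a) t), and a product is at most the sum of the squares. The second square is integrable exactly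
  because 2 r < a; with r = |lambda| n_+ this is the restriction on lambda.\<close>

lemma weight_integrable:
  fixes m :: "real \<Rightarrow> real" and r :: real
  assumes m: "m \<in> borel_measurable borel" and mp: "0 < mp" and a: "0 < a"
    and plus: "set_integrable lborel {0..} (\<lambda>x. \<bar>m x - mp\<bar>\<^sup>2 * exp (2 * a * \<bar>x\<bar>))"
    and minus: "set_integrable lborel {..0} (\<lambda>x. \<bar>m x - mm\<bar>\<^sup>2 * exp (2 * a * \<bar>x\<bar>))"
    and r: "0 \<le> r" "2 * r < a"
  shows "set_integrable lborel {x..} (\<lambda>t. (m t / mp - 1) * exp (2 * r * t))"
proof -
  have [measurable]: "m \<in> borel_measurable borel" by fact
  let ?f = "\<lambda>t. (m t / mp - 1) * exp (2 * r * t)"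
  have f: "?f t = 1 / mp * ((m t - mp) * exp (2 * r * t))" for t
    using mp by (simp add: field_simps)
  have "set_integrable lborel {0..} ?f"
    unfolding f
  proof (intro set_integrable_mult_right, rule set_integrable_dominated)
    show "set_integrable lborel {0..} (\<lambda>t. \<bar>m t - mp\<bar>\<^sup>2 * exp (2 * a * \<bar>t\<bar>) + exp (- (2 * a - 4 * r) * t))"
      using plus r a by (intro set_integral_add(1) set_integrable_exp_neg) auto
    fix t :: real assume "t \<in> {0..}"
    then have t: "\<bar>t\<bar> = t" by simp
    let ?A = "\<bar>m t - mp\<bar> * exp (a * t)" and ?B = "exp ((2 * r - a) * t)"
    have "norm ((m t - mp) * exp (2 * r * t)) = ?A * ?B"
    proof -
      have "exp (a * t) * ?B = exp (2 * r * t)"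
        by (simp add: algebra_simps flip: exp_add)
      then show ?thesis
        by (simp add: abs_mult mult.assoc)
    qed
    also have "\<dots> \<le> ?A\<^sup>2 + ?B\<^sup>2"
      using sum_squares_bound[of ?A ?B] zero_le_power2[of ?A] zero_le_power2[of ?B] by linarith
    also have "\<dots> = \<bar>m t - mp\<bar>\<^sup>2 * exp (2 * a * \<bar>t\<bar>) + exp (- (2 * a - 4 * r) * t)"
      unfolding t by (simp add: power_mult_distrib power2_eq_square algebra_simps flip: exp_add)
    finally show "norm ((m t - mp) * exp (2 * r * t)) \<le> \<bar>m t - mp\<bar>\<^sup>2 * exp (2 * a * \<bar>t\<bar>) + exp (- (2 * a - 4 * r) * t)" .
  qed auto
  \<comment> \<open>The starting point x may be negative, so integrability on a bounded piece of the
    other half-line is needed. There exp(2 r t) \<le> 1, and y \<le> 1 + y^2 reduces to the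
    hypothesis at minus infinity.\<close>
  moreover have "set_integrable lborel {- \<bar>x\<bar>..0} ?f"
    unfolding f
  proof (intro set_integrable_mult_right, rule set_integrable_dominated)
    have "set_integrable lborel {- \<bar>x\<bar>..0} (\<lambda>t. \<bar>m t - mm\<bar>\<^sup>2 * exp (2 * a * \<bar>t\<bar>))"
      using minus by (rule set_integrable_subset) auto
    moreover have "set_integrable lborel {- \<bar>x\<bar>..0} (\<lambda>t. 1 + \<bar>mm - mp\<bar>)"
      unfolding set_integrable_def by (intro borel_integrable_compact) auto
    ultimately show "set_integrable lborel {- \<bar>x\<bar>..0} (\<lambda>t. \<bar>m t - mm\<bar>\<^sup>2 * exp (2 * a * \<bar>t\<bar>) + (1 + \<bar>mm - mp\<bar>))"
      by (rule set_integral_add(1))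
    fix t assume t: "t \<in> {- \<bar>x\<bar>..0}"
    have "\<bar>m t - mm\<bar> \<le> 1 + \<bar>m t - mm\<bar>\<^sup>2"
    proof -
      have "y \<le> 1 + y\<^sup>2" if "0 \<le> y" for y :: real
        using sum_squares_bound[of y 1] that by simp
      from this[OF abs_ge_zero] show ?thesis .
    qed
    also have "\<bar>m t - mm\<bar>\<^sup>2 \<le> \<bar>m t - mm\<bar>\<^sup>2 * exp (2 * a * \<bar>t\<bar>)"
      using a by (simp add: mult_le_cancel_left1)
    finally have "\<bar>m t - mp\<bar> \<le> \<bar>m t - mm\<bar>\<^sup>2 * exp (2 * a * \<bar>t\<bar>) + (1 + \<bar>mm - mp\<bar>)"
      by linarith
    moreover have "norm ((m t - mp) * exp (2 * r * t)) \<le> \<bar>m t - mp\<bar> * 1"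
      unfolding real_norm_def abs_mult using t r by (intro mult_left_mono) (auto simp: mult_nonneg_nonpos)
    ultimately show "norm ((m t - mp) * exp (2 * r * t)) \<le> \<bar>m t - mm\<bar>\<^sup>2 * exp (2 * a * \<bar>t\<bar>) + (1 + \<bar>mm - mp\<bar>)"
      unfolding mult_1_right by (rule order_trans[rotated])
  qed auto
  ultimately have "set_integrable lborel ({- \<bar>x\<bar>..0} \<union> {0..}) ?f"
    by (intro set_integrable_Un) auto
  then show ?thesis
    by (rule set_integrable_subset) auto
qed

lemma set_integrable_lborel_of_lebesgue:
  fixes m m' :: "real \<Rightarrow> real"
  assumes m: "m \<in> borel_measurable lebesgue" "m' \<in> borel_measurable borel" "AE t in lebesgue. m t = m' t"
    and A: "A \<in> sets borel"
    and int: "set_integrable lebesgue A (\<lambda>x. \<bar>m x - c\<bar>\<^sup>2 * exp (b * \<bar>x\<bar>))"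
  shows "set_integrable lborel A (\<lambda>x. \<bar>m' x - c\<bar>\<^sup>2 * exp (b * \<bar>x\<bar>))"
proof -
  have [measurable]: "m' \<in> borel_measurable borel" "A \<in> sets borel" by fact+
  have meas: "(\<lambda>x. indicator A x *\<^sub>R (\<bar>m' x - c\<bar>\<^sup>2 * exp (b * \<bar>x\<bar>))) \<in> borel_measurable lborel"
    by measurable
  have int': "integrable lebesgue (\<lambda>x. indicator A x *\<^sub>R (\<bar>m x - c\<bar>\<^sup>2 * exp (b * \<bar>x\<bar>)))"
    using int unfolding set_integrable_def .
  have "AE x in lebesgue. indicator A x *\<^sub>R (\<bar>m x - c\<bar>\<^sup>2 * exp (b * \<bar>x\<bar>)) = indicator A x *\<^sub>R (\<bar>m' x - c\<bar>\<^sup>2 * exp (b * \<bar>x\<bar>))"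
    using m(3) by eventually_elim simp
  then have "integrable lebesgue (\<lambda>x. indicator A x *\<^sub>R (\<bar>m' x - c\<bar>\<^sup>2 * exp (b * \<bar>x\<bar>)))"
    by (rule integrable_cong_AE[THEN iffD1, OF borel_measurable_integrable[OF int'] measurable_completion[OF meas] _ int'])
  with meas show ?thesis
    unfolding set_integrable_def by (subst (asm) integrable_completion)
qed

lemma set_integrable_reflect:
  fixes f :: "real \<Rightarrow> real"
  assumes "set_integrable lborel A f"
  shows "set_integrable lborel (uminus ` A) (\<lambda>x. f (- x))"
proof -
  have "integrable lborel (\<lambda>x. indicator A (0 + - 1 * x) *\<^sub>R f (0 + - 1 * x))"
    using assms unfolding set_integrable_def by (rule lborel_integrable_real_affine) simp
  moreover have "uminus ` A = uminus -` A"
    by force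
  ultimately show ?thesis
    by (simp add: set_integrable_def indicator_def)
qed

text \<open>J is its own inverse, so the Gram matrix \<alpha> J is invertible and hence so is V.
  Independence of the Jost solutions comes without evaluating a Vandermonde determinant.\<close>

lemma det_jet_matrix_nonzero:
  assumes "V ** S_mat ** conj_transpose V' = mat \<alpha> ** J_mat" "\<alpha> \<noteq> 0"
  shows "det V \<noteq> 0"
proof -
  have "det J_mat * det J_mat = 1"
    using arg_cong[OF J_mat_square, of det] by (simp add: det_mul)
  moreover have "det (mat \<alpha> :: complex ^ 3 ^ 3) = \<alpha> ^ 3"
    by (simp add: det_3 mat_def power3_eq_cube)
  ultimately have "det (mat \<alpha> ** J_mat) \<noteq> 0"
    using assms(2) by (auto simp: det_mul)
  then show ?thesis
    unfolding assms(1)[symmetric] by (auto simp: det_mul)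
qed

theorem lemma2p2:
  fixes m :: "real \<Rightarrow> real" and mp mm a np nm k :: real and lam :: complex
  assumes m_meas: "m \<in> borel_measurable lebesgue"
    and lim_plus: "(m \<longlongrightarrow> mp) at_top"
    and lim_minus: "(m \<longlongrightarrow> mm) at_bot"
    and mp_pos: "0 < mp" and mm_pos: "0 < mm"
    and a_pos: "0 < a"
    and int_plus: "set_integrable lebesgue {0..} (\<lambda>x. \<bar>m x - mp\<bar>\<^sup>2 * exp (2 * a * \<bar>x\<bar>))"
    and int_minus: "set_integrable lebesgue {..0} (\<lambda>x. \<bar>m x - mm\<bar>\<^sup>2 * exp (2 * a * \<bar>x\<bar>))"
    and np_def: "np = root 3 mp" and nm_def: "nm = root 3 mm"
    and k_def: "k = nm / np"
    and lam_pos: "0 < norm lam"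
    and lam_less: "norm lam < a / (2 * max np nm)"
  shows "det (transition_matrix m mp mm lam) = of_real (mm / mp)
    \<and> transition_matrix m mp mm lam ** J_mat ** conj_transpose (transition_matrix m mp mm (cnj lam))
       = k\<^sup>2 *\<^sub>R J_mat"
proof -
  have np: "0 < np" "np ^ 3 = mp" and nm: "0 < nm" "nm ^ 3 = mm"
    using mp_pos mm_pos by (simp_all add: np_def nm_def)
  have "norm lam * max np nm * 2 < a"
    using lam_less np(1) by (simp add: field_simps)
  moreover have "norm lam * np \<le> norm lam * max np nm" "norm lam * nm \<le> norm lam * max np nm"
    by (auto intro: mult_left_mono)
  ultimately have small: "2 * (norm lam * np) < a" "2 * (norm lam * nm) < a"
    by linarith+
  obtain m' where m': "m' \<in> borel_measurable borel" "AE t in lebesgue. m t = m' t"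
    using completion_ex_borel_measurable_real[OF m_meas] by (auto intro: AE_completion)
  note m = m_meas m'
  have ip: "set_integrable lborel {0..} (\<lambda>x. \<bar>m' x - mp\<bar>\<^sup>2 * exp (2 * a * \<bar>x\<bar>))"
    and im: "set_integrable lborel {..0} (\<lambda>x. \<bar>m' x - mm\<bar>\<^sup>2 * exp (2 * a * \<bar>x\<bar>))"
    using set_integrable_lborel_of_lebesgue[OF m _ int_plus] set_integrable_lborel_of_lebesgue[OF m _ int_minus]
    by auto
  \<comment> \<open>Stated for every \<open>l\<close> of the same modulus, to serve both lambda and
    its conjugate.\<close>
  have weight_plus: "set_integrable lborel {x..} (\<lambda>t. (m' t / mp - 1) * exp (2 * norm (l * of_real (root 3 mp)) * t))"
    if "norm l = norm lam" for l :: complex and x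
    using weight_integrable[OF m'(1) mp_pos a_pos ip im, of "norm lam * np"] small np(1) that
    by (simp add: norm_mult np_def mult.assoc)
  have "(\<lambda>x. m' (- x)) \<in> borel_measurable borel"
    using m'(1) by measurable
  note m'_reflect = this
  have "set_integrable lborel {0..} (\<lambda>x. \<bar>m' (- x) - mm\<bar>\<^sup>2 * exp (2 * a * \<bar>x\<bar>))"
    "set_integrable lborel {..0} (\<lambda>x. \<bar>m' (- x) - mp\<bar>\<^sup>2 * exp (2 * a * \<bar>x\<bar>))"
    using set_integrable_reflect[OF im] set_integrable_reflect[OF ip] by simp_all
  note weight_integrable[OF m'_reflect mm_pos a_pos this, of "norm lam * nm"]
  then have weight_minus: "set_integrable lborel {x..} (\<lambda>t. (m' (- t) / mm - 1) * exp (2 * norm (l * of_real (root 3 mm)) * t))"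
    if "norm l = norm lam" for l :: complex and x
    using small nm(1) that by (simp add: norm_mult nm_def mult.assoc)

  obtain V U where sys: "jost_system (- \<i> * lam ^ 3) m' (\<i> * (lam * of_real np)) V"
      "jost_system (\<i> * lam ^ 3) (\<lambda>x. m' (- x)) (- \<i> * (lam * of_real nm)) U"
    and jost: "\<And>k x. V k 0 x = jost_plus m mp k lam x" "\<And>k x. reflect U k 0 x = jost_minus m mm k lam x"
    using jost_data[OF m mp_pos mm_pos weight_plus weight_minus, of lam] unfolding np_def nm_def by auto
  obtain V' U' where sys': "jost_system (- \<i> * cnj lam ^ 3) m' (\<i> * (cnj lam * of_real np)) V'"
      "jost_system (\<i> * cnj lam ^ 3) (\<lambda>x. m' (- x)) (- \<i> * (cnj lam * of_real nm)) U'"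
    and jost': "\<And>k x. V' k 0 x = jost_plus m mp k (cnj lam) x" "\<And>k x. reflect U' k 0 x = jost_minus m mm k (cnj lam) x"
    using jost_data[OF m mp_pos mm_pos weight_plus weight_minus, of "cnj lam"] unfolding np_def nm_def by auto

  \<comment> \<open>The Gram constants 3 kappa^2: \<alpha> and \<alpha>' at plus infinity for lambda
    and its conjugate, one to expand \<open>U\<close> and the other to expand \<open>U'\<close>;
    \<beta> at minus infinity.\<close>
  define \<alpha> where "\<alpha> = 3 * (\<i> * (lam * of_real np))\<^sup>2"
  define \<alpha>' where "\<alpha>' = 3 * (\<i> * (cnj lam * of_real np))\<^sup>2"
  define \<beta> where "\<beta> = 3 * (- \<i> * (lam * of_real nm))\<^sup>2"
  have \<alpha>: "\<alpha> \<noteq> 0" "\<alpha>' \<noteq> 0"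
    using lam_pos np(1) by (auto simp: \<alpha>_def \<alpha>'_def)
  have VV': "jet_matrix V x ** S_mat ** conj_transpose (jet_matrix V' x) = mat \<alpha> ** J_mat" for x
    unfolding \<alpha>_def by (rule jost_system_form[OF sys(1)]) (use sys'(1) in auto)
  have V'V: "jet_matrix V' x ** S_mat ** conj_transpose (jet_matrix V x) = mat \<alpha>' ** J_mat" for x
    unfolding \<alpha>'_def by (rule jost_system_form[OF sys'(1)]) (use sys(1) in auto)
  have UU': "jet_matrix (reflect U) x ** S_mat ** conj_transpose (jet_matrix (reflect U') x) = mat \<beta> ** J_mat" for x
    unfolding \<beta>_def reflect_form by (rule jost_system_form[OF sys(2)]) (use sys'(2) in auto)

  have V: "solves (- \<i> * lam ^ 3) m' (V j)" and V': "solves (- \<i> * cnj lam ^ 3) m' (V' j)" if "j < 3" for j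
    using sys(1) sys'(1) that by (auto simp: jost_system_def)
  have U: "solves (- \<i> * lam ^ 3) m' (reflect U j)" and U': "solves (- \<i> * cnj lam ^ 3) m' (reflect U' j)" if "j < 3" for j
    using sys(2) sys'(2) that solves_reflect[of "\<i> * lam ^ 3" "\<lambda>x. m' (- x)" U j]
      solves_reflect[of "\<i> * cnj lam ^ 3" "\<lambda>x. m' (- x)" U' j] by (auto simp: jost_system_def)
  \<comment> \<open>Brackets between solutions from opposite ends are never evaluated; their
    constancy alone makes T independent of x.\<close>
  have cross: "jet_matrix Y x ** S_mat ** conj_transpose (jet_matrix W x) =
      jet_matrix Y 0 ** S_mat ** conj_transpose (jet_matrix W 0)"
    if "\<And>j. j < 3 \<Longrightarrow> solves (- \<i> * l ^ 3) m' (Y j)" "\<And>j. j < 3 \<Longrightarrow> solves (- \<i> * cnj l ^ 3) m' (W j)" for l Y W x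
  proof -
    have "bform (Y i) (W j) x = bform (Y i) (W j) 0" if "i < 3" "j < 3" for i j
      using \<open>i < 3 \<Longrightarrow> solves (- \<i> * l ^ 3) m' (Y i)\<close> \<open>j < 3 \<Longrightarrow> solves (- \<i> * cnj l ^ 3) m' (W j)\<close> that
      by (intro bform_const) auto
    then show ?thesis
      by (simp add: jet_matrix_form)
  qed
  have "jet_matrix (reflect U) x ** S_mat ** conj_transpose (jet_matrix V' x) =
      jet_matrix (reflect U) 0 ** S_mat ** conj_transpose (jet_matrix V' 0)" for x
    by (rule cross[of lam]) (use U V' in auto)
  from transition_exists[OF VV' \<alpha>(1) this]
  obtain T where T: "\<And>x. jet_matrix (reflect U) x = T ** jet_matrix V x"
    by blast
  have "jet_matrix (reflect U') x ** S_mat ** conj_transpose (jet_matrix V x) =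
      jet_matrix (reflect U') 0 ** S_mat ** conj_transpose (jet_matrix V 0)" for x
    by (rule cross[of "cnj lam"]) (use U' V in auto)
  from transition_exists[OF V'V \<alpha>(2) this]
  obtain T' where T': "\<And>x. jet_matrix (reflect U') x = T' ** jet_matrix V' x"
    by blast
  have det_V: "det (jet_matrix V 0) \<noteq> 0" and det_V': "det (jet_matrix V' 0) \<noteq> 0"
    using det_jet_matrix_nonzero[OF VV' \<alpha>(1)] det_jet_matrix_nonzero[OF V'V \<alpha>(2)] .
  have tm: "transition_matrix m mp mm lam = T" "transition_matrix m mp mm (cnj lam) = T'"
    using transition_matrix_eq[OF V det_V jost T] transition_matrix_eq[OF V' det_V' jost' T'] by simp_all

  have "T ** J_mat ** conj_transpose T' = mat (\<beta> / \<alpha>) ** J_mat"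
    by (rule transition_J_unitary[OF VV' \<alpha>(1) UU' T T'])
  also have "\<beta> / \<alpha> = of_real (k\<^sup>2)"
    using lam_pos np(1) by (simp add: \<alpha>_def \<beta>_def k_def power_mult_distrib power_divide)
  also have "mat (of_real (k\<^sup>2)) ** J_mat = k\<^sup>2 *\<^sub>R J_mat"
    unfolding vec_eq_iff mat_mult_nth vector_scaleR_component by (simp add: scaleR_conv_of_real)
  finally have J: "T ** J_mat ** conj_transpose T' = k\<^sup>2 *\<^sub>R J_mat" .

  let ?D = "det (jet_matrix (\<lambda>k n x. zeta k ^ n) 0)"
  have dV: "det (jet_matrix V 0) = (\<i> * (lam * of_real np)) ^ 3 * ?D"
    by (rule det_jost_system[OF sys(1)])
  \<comment> \<open>The sign from reflecting the jets cancels against (-1)^3 in the cube of - i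
    lambda n_-, which leaves a positive ratio.\<close>
  have "det T * det (jet_matrix V 0) = - ((- \<i> * (lam * of_real nm)) ^ 3 * ?D)"
    using det_reflect[of U 0] det_jost_system[OF sys(2), of 0] T[of 0] by (simp add: det_mul)
  \<comment> \<open>The Vandermonde factor may be cancelled: it divides the nonzero determinant of
    the jet matrix of V.\<close>
  then have "det T * of_real (np ^ 3) = of_real (nm ^ 3)"
    using det_V lam_pos unfolding dV by (simp add: power_mult_distrib)
  then have "det T = of_real (mm / mp)"
    using mp_pos by (simp add: np nm field_simps)
  with J show ?thesis
    by (simp add: tm)
qed

end
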